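(* For every $n\ge4$, $$\log_2\!\left(\frac{n-1}{n-2}\right)\le q(n)\le\begin{cases}2\log_2\!\left(\dfrac{n}{n-2}\right), & n\text{ even},\\[1ex]\log_2\!\left(\dfrac{n+1}{n-3}\right), & n\text{ odd}.\end{cases}$$ In particular, $q(n)=\Theta(1/n)$ as $n\to\infty$.
   Context: For $q>0$, a weak $\mathbb T_q$-representation of the rank-$2$ uniform matroid $U_{2,n}$ is a family of positive reals $(\rho_{ij})_{1\le i<j\le n}$ such that for all $1\le i<j<k<\ell\le n$ the three numbers $(\rho_{ij}\rho_{k\ell})^{1/q}$, $(\rho_{ik}\rho_{j\ell})^{1/q}$, $(\rho_{i\ell}\rho_{jk})^{1/q}$ are the side lengths of a (possibly degenerate) Euclidean triangle (each is at most the sum of the other two). It is identified with the quadratic form $\sum_{i<j}\rho_{ij}x_ix_j$. A quadratic form with nonnegative coefficients in $x_1,\dots,x_n$ is Lorentzian if it is a limit of quadratic forms with nonnegative coefficients whose Hessians have exactly one positive and $n-1$ negative eigenvalues (equivalently, its Hessian has at most one positive eigenvalue). $\mathrm{Gr}^{\mathrm w}_{U_{2,n}}(\mathbb T_q)$ is the set of weak $\mathbb T_q$-representations of $U_{2,n}$ modulo positive scaling, and $\mathbb P\mathrm L_{U_{2,n}}$ is the set of Lorentzian quadratic forms whose set of monomials with nonzero coefficient is exactly $\{x_ix_j:1\le i<j\le n\}$, modulo positive scaling. Define $$q(n):=\sup\{q>0 \mid \mathrm{Gr}^{\mathrm w}_{U_{2,n}}(\mathbb T_q)\subseteq\mathbb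 P\mathrm L_{U_{2,n}}\}.$$ *)

theory Defs
  imports
    "HOL-Analysis.Analysis"
    "HOL-Library.Landau_Symbols"
    "Jordan_Normal_Form.Char_Poly"
begin

text \<open>
  A quadratic form \<open>\<Sum>i\<le>j. c i j * x i * x j\<close> in \<open>n\<close> variables is given by its coefficient family
  \<open>c\<close>, which vanishes outside \<open>i \<le> j < n\<close> so that forms and families correspond bijectively. All
  indices run over \<open>0, \<dots>, n - 1\<close> instead of \<open>1, \<dots>, n\<close>, as in \<^typ>\<open>real mat\<close>.
\<close>

type_synonym qform = "nat \<Rightarrow> nat \<Rightarrow> real"

definition qforms :: "nat \<Rightarrow> qform set" where
  "qforms n = {c. \<forall>i j. \<not> (i \<le> j \<and> j < n) \<longrightarrow> c i j = 0}"

definition qform_eval :: "nat \<Rightarrow> qform \<Rightarrow> (nat \<Rightarrow> real) \<Rightarrow> real" where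
  "qform_eval n c x = (\<Sum>j<n. \<Sum>i\<le>j. c i j * x i * x j)"

definition nonneg_coeffs :: "qform \<Rightarrow> bool" where
  "nonneg_coeffs c \<longleftrightarrow> (\<forall>i j. 0 \<le> c i j)"

definition hessian :: "nat \<Rightarrow> qform \<Rightarrow> real mat" where
  "hessian n c = mat n n (\<lambda>(i, j). if i = j then 2 * c i i else c (min i j) (max i j))"

lemma hessian_quadratic:
  "2 * qform_eval n c x = (\<Sum>i<n. \<Sum>j<n. hessian n c $$ (i, j) * x i * x j)"
proof (induction n)
  case 0
  show ?case by (simp add: qform_eval_def)
next
  case (Suc n)
  have "(\<Sum>i<n. \<Sum>j<n. hessian (Suc n) c $$ (i, j) * x i * x j) =
      (\<Sum>i<n. \<Sum>j<n. hessian n c $$ (i, j) * x i * x j)"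
    by (intro sum.cong refl) (simp add: hessian_def)
  moreover have "(\<Sum>i<n. hessian (Suc n) c $$ (i, n) * x i * x n) = (\<Sum>i<n. c i n * x i * x n)"
    by (intro sum.cong refl) (simp add: hessian_def)
  moreover have "(\<Sum>j<n. hessian (Suc n) c $$ (n, j) * x n * x j) = (\<Sum>j<n. c j n * x j * x n)"
    by (intro sum.cong refl) (simp add: hessian_def)
  moreover have "hessian (Suc n) c $$ (n, n) = 2 * c n n"
    by (simp add: hessian_def)
  moreover have "(\<Sum>i\<le>n. c i n * x i * x n) = (\<Sum>i<n. c i n * x i * x n) + c n n * x n * x n"
    by (simp flip: lessThan_Suc_atMost)
  ultimately show ?case
    using Suc.IH by (simp add: qform_eval_def sum.distrib algebra_simps)
qed

text \<open>Eigenvalues are counted with multiplicity.\<close>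

definition strictly_lorentzian :: "nat \<Rightarrow> qform \<Rightarrow> bool" where
  "strictly_lorentzian n c \<longleftrightarrow> c \<in> qforms n \<and> nonneg_coeffs c \<and>
     size (filter_mset (\<lambda>a. a > 0) (proots (char_poly (hessian n c)))) = 1 \<and>
     size (filter_mset (\<lambda>a. a < 0) (proots (char_poly (hessian n c)))) = n - 1"

definition lorentzian :: "nat \<Rightarrow> qform \<Rightarrow> bool" where
  "lorentzian n c \<longleftrightarrow> c \<in> qforms n \<and> nonneg_coeffs c \<and>
     (\<exists>F :: nat \<Rightarrow> qform. (\<forall>m. strictly_lorentzian n (F m)) \<and>
        (\<forall>i j. (\<lambda>m. F m i j) \<longlonglongrightarrow> c i j))"

definition triangle_sides :: "real \<Rightarrow> real \<Rightarrow> real \<Rightarrow> bool" where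
  "triangle_sides a b c \<longleftrightarrow> a \<le> b + c \<and> b \<le> a + c \<and> c \<le> a + b"

definition weak_rep :: "real \<Rightarrow> nat \<Rightarrow> (nat \<Rightarrow> nat \<Rightarrow> real) \<Rightarrow> bool" where
  "weak_rep q n \<rho> \<longleftrightarrow>
     (\<forall>i j. i < j \<and> j < n \<longrightarrow> 0 < \<rho> i j) \<and>
     (\<forall>i j k l. i < j \<and> j < k \<and> k < l \<and> l < n \<longrightarrow>
        triangle_sides ((\<rho> i j * \<rho> k l) powr (1 / q))
                       ((\<rho> i k * \<rho> j l) powr (1 / q))
                       ((\<rho> i l * \<rho> j k) powr (1 / q)))"

definition form_of_rep :: "nat \<Rightarrow> (nat \<Rightarrow> nat \<Rightarrow> real) \<Rightarrow> qform" where
  "form_of_rep n \<rho> = (\<lambda>i j. if i < j \<and> j < n then \<rho> i j else 0)"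

definition pos_scaling :: "nat \<Rightarrow> qform rel" where
  "pos_scaling n = {(c, d). c \<in> qforms n \<and> d \<in> qforms n \<and> (\<exists>t>0. \<forall>i j. d i j = t * c i j)}"

definition Gr_w_U2 :: "real \<Rightarrow> nat \<Rightarrow> qform set set" where
  "Gr_w_U2 q n = {form_of_rep n \<rho> | \<rho>. weak_rep q n \<rho>} // pos_scaling n"

definition PL_U2 :: "nat \<Rightarrow> qform set set" where
  "PL_U2 n = {c. lorentzian n c \<and> {(i, j). c i j \<noteq> 0} = {(i, j). i < j \<and> j < n}} // pos_scaling n"

text \<open>The supremum is taken in \<^typ>\<open>ereal\<close>, where it always exists.\<close>

definition q_crit :: "nat \<Rightarrow> ereal" where
  "q_crit n = Sup (ereal ` {q. q > 0 \<and> Gr_w_U2 q n \<subseteq> PL_U2 n})"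

end

theory Submission
  imports Defs "Jordan_Normal_Form.Spectral_Radius"
begin

text \<open>
  \<^bold>\<open>Lower bound.\<close> Let \<open>m = n - 1\<close> be the last index and \<open>r\<^sub>i = \<rho>\<^sub>i\<^sub>m\<close>. In the Hessian of the form of a
  weak representation \<open>\<rho>\<close>, the row of \<open>m\<close> is \<open>r\<close> and the diagonal vanishes, so the form is Lorentzian
  as soon as the matrix \<open>\<rho>\<^sub>i\<^sub>j / (r\<^sub>i r\<^sub>j)\<close> on the other indices, with zero diagonal, is
  nonpositive as a quadratic form on vectors with sum \<open>0\<close>. By the four-point condition this matrix is
  \<open>d\<^sup>q\<close> for a metric \<open>d\<close> on \<open>m\<close> points. So the question is when \<open>d\<^sup>q\<close> is of negative type. Let
  \<open>\<Sum> y\<^sub>i = 0\<close>, take the nearest pair of a point with \<open>y\<^sub>i > 0\<close> and a point with \<open>y\<^sub>k < 0\<close>, and move as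
  much mass as possible from \<open>i\<close> to \<open>k\<close>, so that the support of \<open>y\<close> shrinks. Because the pair is
  nearest, concavity of \<open>t\<^sup>q\<close> for \<open>q \<le> 1\<close> bounds the change of the quadratic form by \<open>d\<^sub>i\<^sub>k\<^sup>q\<close> times an expression
  in the moved masses with the constant \<open>2\<^sup>q - 1\<close>. The distances do not decrease from step to step and there
  are at most \<open>m - 1\<close> steps, so the Cauchy--Schwarz inequality makes the total nonpositive if
  \<open>(2\<^sup>q - 1) (m - 1) \<le> 2\<^sup>q\<close>; see \<open>transport_negative_type_bound\<close> and \<open>metric_powr_negative_type\<close>. The
  number \<open>q = log 2 ((n - 1) / (n - 2))\<close> satisfies this condition.

  Lorentzian forms are defined as limits of forms with prescribed numbers of eigenvalues, so a form as
  above is perturbed to have signature \<open>(1, n - 1)\<close>. The spectral theorem for real symmetric matrices,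
  \<open>real_spectral_theorem\<close>, relates this to the roots of the characteristic polynomial
  (\<open>strictly_lorentzianI\<close>).

  \<^bold>\<open>Upper bound.\<close> A Lorentzian form satisfies the reversed Cauchy--Schwarz inequality
  (\<open>lorentzian_reverse_Cauchy_Schwarz\<close>). Divide the indices into two parts of sizes \<open>a\<close> and \<open>b\<close> and let
  \<open>\<rho>\<^sub>i\<^sub>j\<close> be \<open>2\<^bsup>q/2\<^esup>\<close> within the parts and \<open>1\<close> across. This is a weak representation, and the inequality
  for the indicator vectors of the parts says \<open>2\<^sup>q (a - 1) (b - 1) \<le> a b\<close>. The bounds for even and odd
  \<open>n\<close> are the cases \<open>a = b\<close> and \<open>b = a + 1\<close>.
\<close>

section \<open>Powers of finite metrics of negative type\<close>

text \<open>
  The arithmetic of one transport step. It combines the Cauchy--Schwarz inequality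
  \<open>(D' + t)\<^sup>2 / N \<le> D'\<^sup>2 / (N - 1) + t\<^sup>2\<close> with \<open>b \<le> b'\<close>; the latter helps because the bound is a
  nonpositive multiple of \<open>b\<close>. For \<open>N = 1\<close> the quotients by \<open>N - 1\<close> are \<open>0\<close> by convention, and \<open>D' = 0\<close>.
\<close>

lemma transport_step_bound:
  fixes e K N b b' D D' t :: real
  assumes K: "K = 1 + e" and e: "e \<ge> 0" and N: "N \<ge> 1" and eN: "e * N \<le> K"
    and b: "0 \<le> b" "b \<le> b'" and D: "D = D' + t" and D'N: "N = 1 \<Longrightarrow> D' = 0"
  shows "2 * b' * D'^2 * (e - K / (N - 1)) + 2 * b' * t * (2 * e * D' - t) \<le> 2 * b * D^2 * (e - K / N)"
proof -
  have fr: "D^2 / N \<le> D'^2 / (N - 1) + t^2"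
  proof (cases "N = 1")
    case True then show ?thesis using D'N D by simp
  next
    case False
    then have N1: "N - 1 > 0" using N by simp
    have "0 \<le> (D' - (N - 1) * t)^2" by simp
    then have "(D' + t)^2 * (N - 1) \<le> D'^2 * N + t^2 * ((N - 1) * N)"
      by (simp add: power2_eq_square algebra_simps)
    then show ?thesis unfolding D using N1 N by (simp add: field_simps)
  qed
  have "D'^2 * (e - K / (N - 1)) + t * (2 * e * D' - t) = e * D^2 - K * (D'^2 / (N - 1) + t^2)"
    unfolding D K by (simp add: power2_eq_square algebra_simps diff_divide_distrib add_divide_distrib)
  also have "\<dots> \<le> e * D^2 - K * (D^2 / N)"
    using mult_left_mono[OF fr, of K] K e by simp
  also have "\<dots> = D^2 * (e - K / N)" by (simp add: algebra_simps)
  finally have 1: "D'^2 * (e - K / (N - 1)) + t * (2 * e * D' - t) \<le> D^2 * (e - K / N)" .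
  have "e - K / N \<le> 0" using eN N by (simp add: field_simps)
  then have neg: "D^2 * (e - K / N) \<le> 0" by (simp add: mult_nonneg_nonpos)
  have "2 * b' * (D'^2 * (e - K / (N - 1)) + t * (2 * e * D' - t)) \<le> 2 * b' * (D^2 * (e - K / N))"
    using 1 b by (intro mult_left_mono) auto
  also have "\<dots> \<le> 2 * b * (D^2 * (e - K / N))"
    using neg b by (intro mult_right_mono_neg) auto
  finally show ?thesis by (simp add: algebra_simps)
qed

text \<open>
  Moving mass \<open>t\<close> from \<open>i\<close> to \<open>k\<close> changes the quadratic form by a gradient term and by
  the square term \<open>t\<^sup>2\<close> times the value of the form at \<open>e\<^sub>i - e\<^sub>k\<close>, which is \<open>- 2 * B i k\<close>.
\<close>

lemma quadratic_form_transport: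
  fixes B :: "'a \<Rightarrow> 'a \<Rightarrow> real" and y :: "'a \<Rightarrow> real" and t :: real
  assumes S: "finite S" "i \<in> S" "k \<in> S" "i \<noteq> k"
    and sym: "\<And>a b. a \<in> S \<Longrightarrow> b \<in> S \<Longrightarrow> B a b = B b a"
    and diag: "B i i = 0" "B k k = 0"
  defines "z \<equiv> y(i := y i - t, k := y k + t)"
  shows "(\<Sum>a\<in>S. \<Sum>b\<in>S. B a b * y a * y b) =
         (\<Sum>a\<in>S. \<Sum>b\<in>S. B a b * z a * z b)
         + 2 * t * (\<Sum>b\<in>S. (B i b - B k b) * z b) - 2 * t^2 * B i k"
proof -
  define e :: "'a \<Rightarrow> real" where "e a = (if a = i then 1 else 0) - (if a = k then 1 else 0)" for a
  have y: "y a = z a + t * e a" for a unfolding z_def e_def using S by auto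
  have lin: "(\<Sum>a\<in>S. e a * f a) = f i - f k" for f :: "'a \<Rightarrow> real"
    using S by (simp add: e_def left_diff_distrib sum_subtractf if_distrib[of "\<lambda>c. c * _"] sum.delta' cong: if_cong)
  have "(\<Sum>a\<in>S. \<Sum>b\<in>S. B a b * y a * y b) =
     (\<Sum>a\<in>S. \<Sum>b\<in>S. B a b * z a * z b) + t * (\<Sum>a\<in>S. \<Sum>b\<in>S. e b * (B a b * z a))
      + t * (\<Sum>a\<in>S. e a * (\<Sum>b\<in>S. B a b * z b)) + t^2 * (\<Sum>a\<in>S. e a * (\<Sum>b\<in>S. e b * B a b))"
    unfolding y by (simp add: sum_distrib_left sum.distrib algebra_simps power2_eq_square)
  also have "(\<Sum>a\<in>S. \<Sum>b\<in>S. e b * (B a b * z a)) = (\<Sum>b\<in>S. (B i b - B k b) * z b)"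
    unfolding lin using S by (intro sum.cong) (auto simp: sym algebra_simps)
  also have "(\<Sum>a\<in>S. e a * (\<Sum>b\<in>S. B a b * z b)) = (\<Sum>b\<in>S. (B i b - B k b) * z b)"
    unfolding lin by (simp add: sum_subtractf algebra_simps)
  also have "(\<Sum>a\<in>S. e a * (\<Sum>b\<in>S. e b * B a b)) = - 2 * B i k"
    unfolding lin using diag sym[of i k] S by simp
  finally show ?thesis by (simp add: algebra_simps)
qed

text \<open>
  The main inequality. The last condition on \<open>B\<close> is what remains of the metric in \<open>B = d\<^sup>q\<close>, with
  \<open>e = 2\<^sup>q - 1\<close>: if \<open>i\<close> is at least as near to \<open>k\<close> as \<open>j\<close> is, then \<open>B i j\<close> exceeds
  \<open>B k j\<close> by at most \<open>e * B i k\<close>. Writing \<open>D\<close> for half the \<open>\<ell>\<^sub>1\<close>-norm of \<open>y\<close>, the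
  strengthening by the factor \<open>b\<close>, a lower bound for \<open>B\<close> between the positive and the negative support
  of \<open>y\<close>, is what makes the induction on the number of points work.
\<close>

lemma transport_negative_type_bound:
  fixes B :: "'a \<Rightarrow> 'a \<Rightarrow> real"
  assumes "finite S" and e: "e \<ge> 0" and "S \<noteq> {}"
    and "e * (real (card S) - 1) \<le> 1 + e"
    and "\<And>a b. a \<in> S \<Longrightarrow> b \<in> S \<Longrightarrow> B a b = B b a"
    and "\<And>a. a \<in> S \<Longrightarrow> B a a = 0"
    and "\<And>i j k. i \<in> S \<Longrightarrow> j \<in> S \<Longrightarrow> k \<in> S \<Longrightarrow> B i k \<le> B k j \<Longrightarrow> B i j \<le> B k j + e * B i k"
    and "(\<Sum>a\<in>S. y a) = 0"
    and "b \<ge> 0" and "\<And>i k. i \<in> S \<Longrightarrow> k \<in> S \<Longrightarrow> y i > 0 \<Longrightarrow> y k < 0 \<Longrightarrow> b \<le> B i k"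
  shows "(\<Sum>a\<in>S. \<Sum>c\<in>S. B a c * y a * y c)
         \<le> 2 * b * ((\<Sum>a\<in>S. \<bar>y a\<bar>) / 2)^2 * (e - (1 + e) / (real (card S) - 1))"
  using assms(1,3-)
proof (induction "card S" arbitrary: S y b)
  case 0
  then show ?case by simp
next
  case (Suc s)
  note fin = \<open>finite S\<close> and sym = Suc.prems(4) and diag = Suc.prems(5) and step = Suc.prems(6)
    and sum0 = Suc.prems(7)
  show ?case
  proof (cases "\<forall>a\<in>S. y a = 0")
    case True
    then show ?thesis by simp
  next
    case False
    have ex_pos: "\<exists>a\<in>S. y a > 0"
    proof (rule ccontr)
      assume "\<not> ?thesis"
      then have "\<And>a. a \<in> S \<Longrightarrow> 0 \<le> - y a" by force
      then have "\<forall>a\<in>S. - y a = 0"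
        using sum_nonneg_eq_0_iff[OF fin, of "\<lambda>a. - y a"] sum0 by (simp add: sum_negf)
      then show False using False by auto
    qed
    have ex_neg: "\<exists>a\<in>S. y a < 0"
    proof (rule ccontr)
      assume "\<not> ?thesis"
      then have "\<And>a. a \<in> S \<Longrightarrow> 0 \<le> y a" by force
      then have "\<forall>a\<in>S. y a = 0"
        using sum_nonneg_eq_0_iff[OF fin, of y] sum0 by simp
      then show False using False by auto
    qed
    \<comment> \<open>transport between the nearest pair of a positive and a negative point\<close>
    define X where "X = {a \<in> S. y a > 0} \<times> {a \<in> S. y a < 0}"
    have "finite X" "X \<noteq> {}" using fin ex_pos ex_neg by (auto simp: X_def)
    then obtain p where p: "p \<in> X" and pmin: "\<And>p'. p' \<in> X \<Longrightarrow> B (fst p) (snd p) \<le> B (fst p') (snd p')"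
      using ex_min_if_finite[of "(\<lambda>p. B (fst p) (snd p)) ` X"] by (force simp: not_less)
    define i k where "i = fst p" and "k = snd p"
    have i: "i \<in> S" "y i > 0" and k: "k \<in> S" "y k < 0" using p by (auto simp: X_def i_def k_def)
    have min: "B i k \<le> B a c" if "a \<in> S" "c \<in> S" "y a > 0" "y c < 0" for a c
      using pmin[of "(a, c)"] that by (auto simp: X_def i_def k_def)
    have ik: "i \<noteq> k" using i k by auto
    have bik: "b \<le> B i k" using Suc.prems(9) i k by auto
    define t where "t = min (y i) (- y k)"
    have t: "t > 0" using i k by (simp add: t_def)
    define z where "z = y(i := y i - t, k := y k + t)"
    have zi: "z i = y i - t" and zk: "z k = y k + t" and zo: "\<And>a. a \<noteq> i \<Longrightarrow> a \<noteq> k \<Longrightarrow> z a = y a"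
      using ik by (auto simp: z_def)
    have zi0: "z i \<ge> 0" and zk0: "z k \<le> 0" unfolding zi zk t_def by auto
    have zpos: "y a > 0" if "z a > 0" for a
      using that i zo[of a] zk0 by (cases "a = i"; cases "a = k") auto
    have zneg: "y a < 0" if "z a < 0" for a
      using that k zo[of a] zi0 by (cases "a = i"; cases "a = k") auto
    have split: "(\<Sum>a\<in>S. f a) = f i + f k + (\<Sum>a\<in>S - {i, k}. f a)" for f :: "'a \<Rightarrow> real"
    proof -
      have "S = insert i (insert k (S - {i, k}))" using i k by auto
      then have "sum f S = sum f (insert i (insert k (S - {i, k})))" by simp
      also have "\<dots> = f i + f k + (\<Sum>a\<in>S - {i, k}. f a)" using ik fin by simp
      finally show ?thesis .
    qed
    have same: "(\<Sum>a\<in>S - {i, k}. f (z a)) = (\<Sum>a\<in>S - {i, k}. f (y a))" for f :: "real \<Rightarrow> real"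
      by (intro sum.cong) (auto simp: zo)
    have zsum: "(\<Sum>a\<in>S. z a) = 0"
      using sum0 same[of "\<lambda>x. x"] unfolding split zi zk by simp
    define D where "D = (\<Sum>a\<in>S. \<bar>y a\<bar>) / 2"
    define D' where "D' = (\<Sum>a\<in>S. \<bar>z a\<bar>) / 2"
    have DD: "D = D' + t"
      unfolding D_def D'_def split same[of abs] using zi0 zk0 i k unfolding zi zk by (simp add: field_simps)
    \<comment> \<open>\<open>t\<close> is the largest admissible mass, so that \<open>z\<close> vanishes at \<open>i\<close> or at \<open>k\<close> and a point can be dropped\<close>
    obtain l where l: "l \<in> S" "z l = 0"
      using i k unfolding zi zk t_def by (cases "y i \<le> - y k") (auto simp: min_def zi zk t_def)
    define S' where "S' = S - {l}"
    have S': "finite S'" "S' \<subseteq> S" "card S' = s" using fin l Suc.hyps(2) by (auto simp: S'_def)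
    have drop: "(\<Sum>a\<in>S. f a) = (\<Sum>a\<in>S'. f a)" if "f l = 0" for f :: "'a \<Rightarrow> real"
      using l fin that by (simp add: S'_def sum.remove)
    have "{i, k} \<subseteq> S" using i k by auto
    then have s1: "s \<ge> 1" using card_mono[OF fin, of "{i, k}"] ik Suc.hyps(2) by simp
    then have S'ne: "S' \<noteq> {}" using S' by auto
    define Q where "Q y = (\<Sum>a\<in>S. \<Sum>c\<in>S. B a c * y a * y c)" for y :: "'a \<Rightarrow> real"
    have Qz: "Q z = (\<Sum>a\<in>S'. \<Sum>c\<in>S'. B a c * z a * z c)"
    proof -
      have "Q z = (\<Sum>a\<in>S'. \<Sum>c\<in>S. B a c * z a * z c)" unfolding Q_def by (rule drop) (simp add: l)
      also have "\<dots> = (\<Sum>a\<in>S'. \<Sum>c\<in>S'. B a c * z a * z c)"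
        by (intro sum.cong refl drop) (simp add: l)
      finally show ?thesis .
    qed
    have cond': "e * (real s - 1) \<le> 1 + e"
    proof -
      have "e * (real s - 1) \<le> e * (real (card S) - 1)" using e Suc.hyps(2) by (intro mult_left_mono) auto
      then show ?thesis using Suc.prems(3) by linarith
    qed
    have Bik0: "0 \<le> B i k" using bik Suc.prems(8) by linarith
    have IH: "Q z \<le> 2 * B i k * D'^2 * (e - (1 + e) / (real s - 1))"
    proof -
      have "(\<Sum>a\<in>S'. \<Sum>c\<in>S'. B a c * z a * z c)
         \<le> 2 * B i k * ((\<Sum>a\<in>S'. \<bar>z a\<bar>) / 2)^2 * (e - (1 + e) / (real (card S') - 1))"
      proof (rule Suc.hyps(1))
        show "s = card S'" "finite S'" "S' \<noteq> {}" using S' S'ne by auto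
        show "e * (real (card S') - 1) \<le> 1 + e" using cond' S' by simp
        show "sum z S' = 0" using zsum drop[of z] l by simp
        show "0 \<le> B i k" by (rule Bik0)
        show "B i k \<le> B a c" if "a \<in> S'" "c \<in> S'" "z a > 0" "z c < 0" for a c
          using that S' by (intro min zpos zneg) auto
      qed (use S' sym diag step in \<open>auto simp: subset_iff\<close>)
      moreover have "(\<Sum>a\<in>S. \<bar>z a\<bar>) = (\<Sum>a\<in>S'. \<bar>z a\<bar>)" by (rule drop) (simp add: l)
      ultimately show ?thesis unfolding Qz D'_def using S' by simp
    qed
    \<comment> \<open>points with \<open>z c > 0\<close> are no nearer to \<open>k\<close> than \<open>i\<close> is, and points with \<open>z c < 0\<close> no nearer to \<open>i\<close> than \<open>k\<close> is\<close>
    have grad: "(\<Sum>c\<in>S. (B i c - B k c) * z c) \<le> B i k * (2 * e * D')"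
    proof -
      have "(\<Sum>c\<in>S. (B i c - B k c) * z c) \<le> (\<Sum>c\<in>S. (e * B i k) * \<bar>z c\<bar>)"
      proof (rule sum_mono)
        fix c assume c: "c \<in> S"
        show "(B i c - B k c) * z c \<le> (e * B i k) * \<bar>z c\<bar>"
        proof (cases "z c > 0")
          case True
          then have "B i k \<le> B k c" using min[of c k] zpos[of c] c k sym[of k c] by simp
          then have "B i c - B k c \<le> e * B i k" using step[of i c k] i k c by simp
          then show ?thesis using True by (simp add: mult_right_mono)
        next
          case False
          show ?thesis
          proof (cases "z c = 0")
            case True
            then show ?thesis by simp
          next
            case F: False
            then have zc: "z c < 0" using False by simp
            then have "B i k \<le> B i c" using min[of i c] zneg[of c] c i by simp
            then have "B k c - B i c \<le> e * B i k" using step[of k c i] i k c sym[of i k] by simp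
            then have "(B k c - B i c) * (- z c) \<le> (e * B i k) * (- z c)"
              using zc by (intro mult_right_mono) auto
            then show ?thesis using zc by (simp add: algebra_simps)
          qed
        qed
      qed
      also have "\<dots> = B i k * (2 * e * D')" by (simp add: D'_def sum_distrib_left[symmetric])
      finally show ?thesis .
    qed
    have "Q y = Q z + 2 * t * (\<Sum>c\<in>S. (B i c - B k c) * z c) - 2 * t^2 * B i k"
      unfolding Q_def z_def
      by (rule quadratic_form_transport) (use fin i k ik sym diag in auto)
    also have "\<dots> \<le> 2 * B i k * D'^2 * (e - (1 + e) / (real s - 1))
                    + 2 * t * (B i k * (2 * e * D')) - 2 * t^2 * B i k"
      using IH mult_left_mono[OF grad, of "2 * t"] t by (intro diff_right_mono add_mono) simp_all
    also have "\<dots> = 2 * B i k * D'^2 * (e - (1 + e) / (real s - 1)) + 2 * B i k * t * (2 * e * D' - t)"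
      by (simp add: power2_eq_square algebra_simps)
    also have "\<dots> \<le> 2 * b * D^2 * (e - (1 + e) / real s)"
    proof (rule transport_step_bound)
      show "e * real s \<le> 1 + e" using Suc.prems(3) Suc.hyps(2)[symmetric] by simp
      show "D' = 0" if "real s = 1"
      proof -
        have "card S' = 1" using that S' by simp
        then obtain a where a: "S' = {a}" by (auto simp: card_1_singleton_iff)
        then have "z a = 0" using zsum drop[of z] l by simp
        moreover have "(\<Sum>a\<in>S. \<bar>z a\<bar>) = (\<Sum>a\<in>S'. \<bar>z a\<bar>)" by (rule drop) (simp add: l)
        ultimately show ?thesis by (simp add: D'_def a)
      qed
    qed (use e s1 bik Suc.prems(8) DD in auto)
    finally show ?thesis unfolding Q_def D_def using Suc.hyps(2)[symmetric] by simp
  qed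
qed

text \<open>
  For \<open>q \<le> 1\<close> the increment \<open>(a + x)\<^sup>q - x\<^sup>q\<close> is decreasing in \<open>x\<close>; compare \<open>x = b\<close> with \<open>x = a\<close>.
\<close>

lemma concave_powr_increment:
  fixes a b c q :: real
  assumes q: "0 < q" "q \<le> 1" and ab: "0 < a" "a \<le> b" and c: "0 \<le> c" "c \<le> a + b"
  shows "c powr q \<le> b powr q + (2 powr q - 1) * a powr q"
proof -
  define f where "f x = (a + x) powr q - x powr q" for x :: real
  have "f b \<le> f a"
  proof (rule DERIV_nonpos_imp_nonincreasing[OF ab(2)])
    fix x assume x: "a \<le> x" "x \<le> b"
    have "(f has_real_derivative (q * (a + x) powr (q - 1) - q * x powr (q - 1))) (at x)"
      unfolding f_def using x ab by (auto intro!: derivative_eq_intros)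
    moreover have "(a + x) powr (q - 1) \<le> x powr (q - 1)"
      using x ab q by (intro powr_mono2') auto
    ultimately show "\<exists>y. (f has_real_derivative y) (at x) \<and> y \<le> 0"
      using q by (intro exI conjI) (auto simp: mult_left_mono)
  qed
  moreover have "(a + a) powr q = 2 powr q * a powr q"
    using ab by (simp add: powr_mult flip: mult_2)
  moreover have "c powr q \<le> (a + b) powr q" using c q by (intro powr_mono2) auto
  ultimately show ?thesis by (simp add: f_def algebra_simps)
qed

text \<open>
  For \<open>0 < q \<le> 1\<close>, the power \<open>d\<^sup>q\<close> of a metric on \<open>m\<close> points is of negative type as soon as
  \<open>(2\<^sup>q - 1) * (m - 1) \<le> 2\<^sup>q\<close>, that is \<open>2\<^sup>q \<le> (m - 1) / (m - 2)\<close> if \<open>m > 2\<close>.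
\<close>

lemma metric_powr_negative_type:
  fixes d :: "'a \<Rightarrow> 'a \<Rightarrow> real"
  assumes S: "finite S" "S \<noteq> {}" and q: "0 < q" "q \<le> 1"
    and qS: "(2 powr q - 1) * (real (card S) - 1) \<le> 2 powr q"
    and sym: "\<And>a b. a \<in> S \<Longrightarrow> b \<in> S \<Longrightarrow> d a b = d b a"
    and diag: "\<And>a. a \<in> S \<Longrightarrow> d a a = 0"
    and pos: "\<And>a b. a \<in> S \<Longrightarrow> b \<in> S \<Longrightarrow> a \<noteq> b \<Longrightarrow> 0 < d a b"
    and tri: "\<And>a b c. a \<in> S \<Longrightarrow> b \<in> S \<Longrightarrow> c \<in> S \<Longrightarrow> d a c \<le> d a b + d b c"
    and y: "(\<Sum>a\<in>S. y a) = 0"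
  shows "(\<Sum>a\<in>S. \<Sum>b\<in>S. d a b powr q * y a * y b) \<le> 0"
proof -
  have "(\<Sum>a\<in>S. \<Sum>b\<in>S. d a b powr q * y a * y b)
       \<le> 2 * 0 * ((\<Sum>a\<in>S. \<bar>y a\<bar>) / 2)^2 *
          ((2 powr q - 1) - (1 + (2 powr q - 1)) / (real (card S) - 1))"
  proof (rule transport_negative_type_bound)
    show "0 \<le> 2 powr q - 1" using q by (simp add: ge_one_powr_ge_zero)
    show "d i j powr q \<le> d k j powr q + (2 powr q - 1) * d i k powr q"
      if S: "i \<in> S" "j \<in> S" "k \<in> S" and le: "d i k powr q \<le> d k j powr q" for i j k
    proof (cases "i = k")
      case True
      then show ?thesis using diag[of k] S by simp
    next
      case False
      then have ik: "0 < d i k" using pos S by auto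
      have nn: "0 \<le> d a b" if "a \<in> S" "b \<in> S" for a b using pos[OF that] diag that by (cases "a = b") auto
      have "d i k \<le> d k j"
        using le q powr_less_mono2[of q "d k j" "d i k"] nn S by (cases "d k j < d i k") auto
      then show ?thesis
        by (intro concave_powr_increment q ik nn tri S)
    qed
  qed (use S qS sym diag y in auto)
  then show ?thesis by simp
qed

section \<open>The spectral theorem for real symmetric matrices\<close>

text \<open>
  A complex eigenvector \<open>u + \<i> w\<close> of a real symmetric matrix has a real eigenvalue, because pairing
  \<open>A u\<close> with \<open>w\<close> and \<open>A w\<close> with \<open>u\<close> gives the same number. So \<open>u\<close> or \<open>w\<close> is a real eigenvector.
\<close>

lemma real_symmetric_eigenvector_exists:
  fixes A :: "real mat"
  assumes A: "A \<in> carrier_mat n n" and n: "n > 0"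
    and sym: "\<And>i j. i < n \<Longrightarrow> j < n \<Longrightarrow> A $$ (i, j) = A $$ (j, i)"
  shows "\<exists>v e. (\<exists>i<n. v i \<noteq> 0) \<and> (\<forall>i<n. (\<Sum>j<n. A $$ (i, j) * v j) = e * v i)"
proof -
  let ?C = "map_mat complex_of_real A"
  have C: "?C \<in> carrier_mat n n" using A by simp
  from spectrum_non_empty[OF C n] obtain k where "eigenvalue ?C k" unfolding spectrum_def by auto
  then obtain v where v: "v \<in> carrier_vec n" "v \<noteq> 0\<^sub>v n" "?C *\<^sub>v v = k \<cdot>\<^sub>v v"
    using A unfolding eigenvalue_def eigenvector_def by auto
  define f where "f i = vec_index v i" for i
  have eig: "(\<Sum>j<n. complex_of_real (A $$ (i, j)) * f j) = k * f i" if "i < n" for i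
  proof -
    have "vec_index (?C *\<^sub>v v) i = (\<Sum>j<n. complex_of_real (A $$ (i, j)) * f j)"
      using that A v(1) by (simp add: scalar_prod_def f_def lessThan_atLeast0)
    then show ?thesis using that v by (simp add: f_def)
  qed
  define u where "u i = Re (f i)" for i
  define w where "w i = Im (f i)" for i
  define a where "a = Re k"
  define b where "b = Im k"
  have Au: "(\<Sum>j<n. A $$ (i, j) * u j) = a * u i - b * w i" if "i < n" for i
    using arg_cong[OF eig[OF that], of Re] by (simp add: u_def w_def a_def b_def)
  have Aw: "(\<Sum>j<n. A $$ (i, j) * w j) = b * u i + a * w i" if "i < n" for i
    using arg_cong[OF eig[OF that], of Im] by (simp add: u_def w_def a_def b_def)
  have ne: "\<exists>i<n. u i \<noteq> 0 \<or> w i \<noteq> 0"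
  proof (rule ccontr)
    assume "\<not> ?thesis"
    then have "f i = 0" if "i < n" for i using that by (auto simp: u_def w_def complex_eq_iff)
    then have "v = 0\<^sub>v n" using v(1) by (intro eq_vecI) (auto simp: f_def)
    then show False using v(2) by simp
  qed
  have "(\<Sum>i<n. w i * (\<Sum>j<n. A $$ (i, j) * u j)) = (\<Sum>i<n. u i * (\<Sum>j<n. A $$ (i, j) * w j))"
    unfolding sum_distrib_left
    by (subst sum.swap, intro sum.cong refl) (auto simp: sym algebra_simps)
  then have "(\<Sum>i<n. w i * (a * u i - b * w i)) = (\<Sum>i<n. u i * (b * u i + a * w i))"
    by (simp add: Au Aw)
  then have "b * (\<Sum>i<n. (u i)^2 + (w i)^2) = 0"
    by (simp add: algebra_simps power2_eq_square sum.distrib sum_subtractf sum_distrib_left)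
  moreover have "(\<Sum>i<n. (u i)^2 + (w i)^2) \<noteq> 0"
    using ne by (subst sum_nonneg_eq_0_iff) (auto simp: sum_power2_eq_zero_iff)
  ultimately have b: "b = 0" by simp
  show ?thesis
  proof (cases "\<exists>i<n. u i \<noteq> 0")
    case True
    then show ?thesis using Au b by (intro exI[of _ u] exI[of _ a]) auto
  next
    case False
    then show ?thesis using ne Aw b by (intro exI[of _ w] exI[of _ a]) auto
  qed
qed

text \<open>
  Every unit vector \<open>v\<close> is the first column of a symmetric orthogonal matrix: the identity if
  \<open>v = e\<^sub>0\<close>, and otherwise the reflection along \<open>v - e\<^sub>0\<close>.
\<close>

lemma householder_exists:
  fixes v :: "nat \<Rightarrow> real"
  assumes n: "n > 0" and v: "(\<Sum>i<n. (v i)^2) = 1"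
  shows "\<exists>H. H \<in> carrier_mat n n \<and> H\<^sup>T = H \<and> H * H = 1\<^sub>m n \<and> (\<forall>i<n. H $$ (i, 0) = v i)"
proof (cases "v 0 = 1")
  case True
  have "(\<Sum>i<n. (v i)^2) = (v 0)^2 + (\<Sum>i\<in>{..<n} - {0}. (v i)^2)"
    using n by (subst sum.remove[of _ 0]) auto
  then have "(\<Sum>i\<in>{..<n} - {0}. (v i)^2) = 0" using v True by simp
  then have "\<forall>i\<in>{..<n} - {0}. (v i)^2 = 0" by (subst (asm) sum_nonneg_eq_0_iff) auto
  then show ?thesis using n True by (intro exI[of _ "1\<^sub>m n"]) auto
next
  case False
  define c where "c = 1 / (1 - v 0)"
  define w where "w i = v i - (if i = 0 then 1 else 0)" for i
  \<comment> \<open>\<open>H = 1 - 2 w w\<^sup>T / |w|\<^sup>2\<close>, where \<open>|w|\<^sup>2 = 2 (1 - v 0)\<close>\<close>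
  have "(\<Sum>i<n. (w i)^2) = (\<Sum>i<n. (v i)^2 - (if i = 0 then 2 * v 0 - 1 else 0))"
    by (intro sum.cong) (auto simp: w_def power2_eq_square algebra_simps)
  also have "\<dots> = 2 * (1 - v 0)" using v n by (simp add: sum_subtractf)
  finally have ww: "c * (\<Sum>i<n. (w i)^2) = 2" using False by (simp add: c_def divide_simps)
  define H where "H = mat n n (\<lambda>(i, j). (if i = j then 1 else 0) - c * w i * w j)"
  have "H * H = 1\<^sub>m n"
  proof (rule eq_matI)
    fix i j assume "i < dim_row (1\<^sub>m n :: real mat)" "j < dim_col (1\<^sub>m n :: real mat)"
    then have ij: "i < n" "j < n" by auto
    have "(H * H) $$ (i, j) = (\<Sum>k<n. ((if i = k then 1 else 0) - c * w i * w k) *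
        ((if k = j then 1 else 0) - c * w k * w j))"
      using ij by (simp add: H_def scalar_prod_def lessThan_atLeast0)
    also have "\<dots> = (\<Sum>k<n. (if k = i then (if i = j then 1 else 0) else 0)
        - (if k = i then c * w i * w j else 0) - (if k = j then c * w i * w j else 0)
        + (c * w i * w j) * (c * (w k)^2))"
      by (intro sum.cong) (auto simp: power2_eq_square algebra_simps)
    also have "\<dots> = (if i = j then 1 else 0) - 2 * (c * w i * w j) + c * w i * w j * (c * (\<Sum>k<n. (w k)^2))"
      using ij by (simp add: sum.distrib sum_subtractf sum_distrib_left)
    also have "\<dots> = (if i = j then 1 else 0)" unfolding ww by simp
    finally show "(H * H) $$ (i, j) = 1\<^sub>m n $$ (i, j)" using ij by simp
  qed (auto simp: H_def)
  moreover have "H $$ (i, 0) = v i" if "i < n" for i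
    using that n False by (auto simp: H_def w_def c_def field_simps)
  ultimately show ?thesis by (intro exI[of _ H]) (auto simp: H_def intro!: eq_matI)
qed

text \<open>
  By induction on the dimension: conjugating with the reflection that maps \<open>e\<^sub>0\<close> to a unit
  eigenvector splits off a \<open>1 \<times> 1\<close> block.
\<close>

lemma real_spectral_theorem:
  fixes A :: "real mat"
  assumes "A \<in> carrier_mat n n" and "A\<^sup>T = A"
  shows "\<exists>P D. P \<in> carrier_mat n n \<and> D \<in> carrier_mat n n \<and> diagonal_mat D \<and>
           P\<^sup>T * P = 1\<^sub>m n \<and> A = P * D * P\<^sup>T"
  using assms
proof (induction n arbitrary: A)
  case 0
  then show ?case by (intro exI[of _ "1\<^sub>m 0"]) (auto simp: diagonal_mat_def)
next
  case (Suc m)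
  let ?n = "Suc m"
  note A = Suc.prems(1)
  have sym: "A $$ (i, j) = A $$ (j, i)" if "i < ?n" "j < ?n" for i j
    using that A Suc.prems(2) by (metis carrier_matD index_transpose_mat(1))
  obtain v e where v: "\<exists>i<?n. v i \<noteq> 0" and eig: "\<forall>i<?n. (\<Sum>j<?n. A $$ (i, j) * v j) = e * v i"
    using real_symmetric_eigenvector_exists[OF A _ sym] by blast
  define r where "r = sqrt (\<Sum>i<?n. (v i)^2)"
  have r2: "r^2 = (\<Sum>i<?n. (v i)^2)" unfolding r_def by (intro real_sqrt_pow2 sum_nonneg) simp
  have "(\<Sum>i<?n. (v i)^2) \<noteq> 0" using v by (subst sum_nonneg_eq_0_iff) auto
  then have r0: "r \<noteq> 0" using r2 by auto
  define u where "u i = v i / r" for i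
  have u1: "(\<Sum>i<?n. (u i)^2) = 1"
    unfolding u_def power_divide sum_divide_distrib[symmetric] r2[symmetric] using r0 by simp
  have ueig: "(\<Sum>j<?n. A $$ (i, j) * u j) = e * u i" if "i < ?n" for i
  proof -
    have "(\<Sum>j<?n. A $$ (i, j) * v j) / r = e * v i / r" using eig that by metis
    then show ?thesis by (simp only: u_def sum_divide_distrib times_divide_eq_right)
  qed
  obtain H where H: "H \<in> carrier_mat ?n ?n" "H\<^sup>T = H" "H * H = 1\<^sub>m ?n" and Hu: "\<forall>i<?n. H $$ (i, 0) = u i"
    using householder_exists[of ?n u] u1 by auto
  define M where "M = H * A * H"
  have M: "M \<in> carrier_mat ?n ?n" using H A by (auto simp: M_def)
  have MT: "M\<^sup>T = M"
    unfolding M_def using H A Suc.prems(2)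
    by (simp add: transpose_mult[of _ ?n ?n _ ?n] assoc_mult_mat[of _ ?n ?n _ ?n _ ?n])
  have Msym: "M $$ (i, j) = M $$ (j, i)" if "i < ?n" "j < ?n" for i j
    using that M MT by (metis carrier_matD index_transpose_mat(1))
  have "col (A * H) 0 = e \<cdot>\<^sub>v col H 0"
  proof (rule eq_vecI)
    fix i assume "i < dim_vec (e \<cdot>\<^sub>v col H 0)"
    then have i: "i < ?n" using H by simp
    have "vec_index (col (A * H) 0) i = (\<Sum>j<?n. A $$ (i, j) * u j)"
      using i A H Hu by (simp add: scalar_prod_def lessThan_atLeast0)
    then show "vec_index (col (A * H) 0) i = vec_index (e \<cdot>\<^sub>v col H 0) i"
      using ueig i H Hu by simp
  qed (use A H in auto)
  then have M0: "M $$ (i, 0) = (if i = 0 then e else 0)" if "i < ?n" for i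
  proof -
    have "M = H * (A * H)" unfolding M_def using A H by (simp add: assoc_mult_mat[of _ ?n ?n _ ?n _ ?n])
    then have "M $$ (i, 0) = row H i \<bullet> col (A * H) 0" using that H A by simp
    also have "\<dots> = e * (row H i \<bullet> col H 0)" unfolding \<open>col (A * H) 0 = _\<close>
      using H(1) that by (intro scalar_prod_smult_distrib[of _ ?n]) (auto intro: carrier_vecI)
    also have "row H i \<bullet> col H 0 = (H * H) $$ (i, 0)" using H(1) that by simp
    also have "\<dots> = (if i = 0 then 1 else 0)" unfolding H(3) using that by simp
    finally show ?thesis by simp
  qed
  define A' where "A' = mat m m (\<lambda>(i, j). M $$ (Suc i, Suc j))"
  define E where "E = mat 1 1 (\<lambda>_. e)"
  have M_block: "M = four_block_mat E (0\<^sub>m 1 m) (0\<^sub>m m 1) A'"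
  proof (rule eq_matI)
    fix i j assume "i < dim_row (four_block_mat E (0\<^sub>m 1 m) (0\<^sub>m m 1) A')"
      "j < dim_col (four_block_mat E (0\<^sub>m 1 m) (0\<^sub>m m 1) A')"
    then have ij: "i < ?n" "j < ?n" by (auto simp: E_def A'_def)
    then show "M $$ (i, j) = four_block_mat E (0\<^sub>m 1 m) (0\<^sub>m m 1) A' $$ (i, j)"
      using M0[of i] M0[of j] Msym[of i j] by (cases i; cases j) (auto simp: E_def A'_def)
  qed (use M in \<open>auto simp: E_def A'_def\<close>)
  have A': "A' \<in> carrier_mat m m" by (simp add: A'_def)
  have E: "E \<in> carrier_mat 1 1" by (simp add: E_def)
  have "A'\<^sup>T = A'" by (rule eq_matI) (auto simp: A'_def Msym)
  from Suc.IH[OF A' this] obtain P D where P: "P \<in> carrier_mat m m" and D: "D \<in> carrier_mat m m"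
    and dD: "diagonal_mat D" and PP: "P\<^sup>T * P = 1\<^sub>m m" and A'P: "A' = P * D * P\<^sup>T" by blast
  define P1 where "P1 = four_block_mat (1\<^sub>m 1) (0\<^sub>m 1 m) (0\<^sub>m m 1) P"
  define D1 where "D1 = four_block_mat E (0\<^sub>m 1 m) (0\<^sub>m m 1) D"
  have P1: "P1 \<in> carrier_mat ?n ?n" unfolding P1_def using four_block_carrier_mat[of "1\<^sub>m 1" 1 1 P m m] P by simp
  have D1: "D1 \<in> carrier_mat ?n ?n" unfolding D1_def using four_block_carrier_mat[OF E D] by simp
  have P1T: "P1\<^sup>T = four_block_mat (1\<^sub>m 1) (0\<^sub>m 1 m) (0\<^sub>m m 1) P\<^sup>T"
    unfolding P1_def by (subst transpose_four_block_mat[of _ 1 1 _ m _ m]) (use P in auto)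
  have PT: "P\<^sup>T \<in> carrier_mat m m" using P by simp
  have P1P1: "P1\<^sup>T * P1 = 1\<^sub>m ?n"
  proof -
    have "P1\<^sup>T * P1 = four_block_mat (1\<^sub>m 1) (0\<^sub>m 1 m) (0\<^sub>m m 1) (1\<^sub>m m)"
      unfolding P1T unfolding P1_def
      by (subst mult_four_block_mat[of _ 1 1 _ m _ m _ _ 1 _ m]) (use P PT PP in auto)
    then show ?thesis using four_block_one_mat[of 1 m] by simp
  qed
  have MP: "M = P1 * D1 * P1\<^sup>T"
  proof -
    have "P1 * D1 = four_block_mat E (0\<^sub>m 1 m) (0\<^sub>m m 1) (P * D)"
      unfolding P1_def D1_def
      by (subst mult_four_block_mat[of _ 1 1 _ m _ m _ _ 1 _ m]) (use P D E in auto)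
    then have "P1 * D1 * P1\<^sup>T = four_block_mat E (0\<^sub>m 1 m) (0\<^sub>m m 1) (P * D * P\<^sup>T)"
      unfolding P1T
      by (simp, subst mult_four_block_mat[of _ 1 1 _ m _ m _ _ 1 _ m]) (use P PT D E in auto)
    then show ?thesis using M_block A'P by simp
  qed
  have dD1: "diagonal_mat D1"
    unfolding diagonal_mat_def
  proof (intro allI impI)
    fix i j assume "i < dim_row D1" "j < dim_col D1" "i \<noteq> j"
    then show "D1 $$ (i, j) = 0"
      using dD D E unfolding D1_def diagonal_mat_def by (cases i; cases j) auto
  qed
  have assoc: "X * Y * Z = X * (Y * Z)" if "X \<in> carrier_mat ?n ?n" "Y \<in> carrier_mat ?n ?n"
    "Z \<in> carrier_mat ?n ?n" for X Y Z :: "real mat" using that by (rule assoc_mult_mat)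
  have P1T': "P1\<^sup>T \<in> carrier_mat ?n ?n" using P1 by simp
  have cc: "X * Y \<in> carrier_mat ?n ?n" if "X \<in> carrier_mat ?n ?n" "Y \<in> carrier_mat ?n ?n"
    for X Y :: "real mat" using that by simp
  have HPT: "(H * P1)\<^sup>T = P1\<^sup>T * H" using transpose_mult[OF H(1) P1] H(2) by simp
  have "(H * P1)\<^sup>T * (H * P1) = P1\<^sup>T * ((H * H) * P1)"
    unfolding HPT by (simp add: assoc H(1) P1 P1T' cc)
  also have "\<dots> = 1\<^sub>m ?n" using P1P1 P1 H(3) by simp
  finally have orth: "(H * P1)\<^sup>T * (H * P1) = 1\<^sub>m ?n" .
  have "H * P1 * D1 * (H * P1)\<^sup>T = H * (P1 * D1 * P1\<^sup>T) * H"
    unfolding HPT by (simp add: assoc H(1) P1 P1T' D1 cc)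
  also have "\<dots> = (H * H) * A * (H * H)"
    unfolding MP[symmetric] M_def by (simp add: assoc H(1) A cc)
  also have "\<dots> = A" using A unfolding H(3) by simp
  finally show ?case
    using orth dD1 D1 H(1) P1 by (intro exI[of _ "H * P1"] exI[of _ D1]) auto
qed

text \<open>
  The columns \<open>p _ k\<close> are orthonormal eigenvectors and the numbers \<open>d k\<close> are the eigenvalues, listed
  with their multiplicities in the characteristic polynomial.
\<close>

lemma symmetric_mat_diagonalization:
  fixes A :: "real mat"
  assumes A: "A \<in> carrier_mat n n" and sym: "A\<^sup>T = A"
  obtains p d where
    "\<And>k l. k < n \<Longrightarrow> l < n \<Longrightarrow> (\<Sum>i<n. p i k * p i l) = (if k = l then 1 else 0)"
    "\<And>i j. i < n \<Longrightarrow> j < n \<Longrightarrow> A $$ (i, j) = (\<Sum>k<n. d k * p i k * p j k)"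
    "proots (char_poly A) = image_mset d (mset_set {..<n})"
proof -
  obtain P D where P: "P \<in> carrier_mat n n" and D: "D \<in> carrier_mat n n" and dD: "diagonal_mat D"
    and PP: "P\<^sup>T * P = 1\<^sub>m n" and APD: "A = P * D * P\<^sup>T"
    using real_spectral_theorem[OF A sym] by blast
  have PT: "P\<^sup>T \<in> carrier_mat n n" using P by simp
  have PP': "P * P\<^sup>T = 1\<^sub>m n" by (rule mat_mult_left_right_inverse[OF PT P PP])
  define p where "p i k = P $$ (i, k)" for i k
  define d where "d k = D $$ (k, k)" for k
  have "similar_mat A D"
    unfolding similar_mat_def similar_mat_wit_def Let_def
    using A D P PT PP PP' APD by (intro exI[of _ P] exI[of _ "P\<^sup>T"]) simp
  then have "char_poly A = char_poly D" by (rule char_poly_similar)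
  also have "\<dots> = (\<Prod>a\<leftarrow>diag_mat D. [:- a, 1:])"
    using D dD by (intro char_poly_upper_triangular[of _ n]) (auto simp: upper_triangular_def diagonal_mat_def)
  also have "\<dots> = (\<Prod>k<n. [:- d k, 1:])"
    using D by (simp add: diag_mat_def d_def o_def lessThan_atLeast0 prod.distinct_set_conv_list[symmetric])
  finally have cp: "char_poly A = (\<Prod>k<n. [:- d k, 1:])" .
  have "proots (\<Prod>k\<in>K. [:- d k, 1:]) = image_mset d (mset_set K)" if "finite K" for K
    using that by (induction K rule: finite_induct) (auto simp: proots_mult prod_zero_iff simp del: mult_pCons_left)
  then have 3: "proots (char_poly A) = image_mset d (mset_set {..<n})" unfolding cp by simp
  have 1: "(\<Sum>i<n. p i k * p i l) = (if k = l then 1 else 0)" if "k < n" "l < n" for k l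
    using arg_cong[OF PP, of "\<lambda>X. X $$ (k, l)"] that P
    by (simp add: scalar_prod_def p_def lessThan_atLeast0)
  have 2: "A $$ (i, j) = (\<Sum>k<n. d k * p i k * p j k)" if ij: "i < n" "j < n" for i j
  proof -
    have PD: "(P * D) $$ (i, k) = p i k * d k" if "k < n" for k
    proof -
      have "(P * D) $$ (i, k) = (\<Sum>l<n. p i l * D $$ (l, k))"
        using P D ij that by (simp add: scalar_prod_def p_def lessThan_atLeast0)
      also have "\<dots> = (\<Sum>l<n. if l = k then p i k * d k else 0)"
        using D dD that by (intro sum.cong) (auto simp: diagonal_mat_def d_def)
      finally show ?thesis using that by simp
    qed
    define X where "X = P * D"
    have X: "X \<in> carrier_mat n n" using P D by (simp add: X_def)
    have "A $$ (i, j) = (\<Sum>k<n. X $$ (i, k) * P\<^sup>T $$ (k, j))"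
      unfolding APD X_def[symmetric] using P X ij by (simp add: scalar_prod_def lessThan_atLeast0)
    also have "\<dots> = (\<Sum>k<n. d k * p i k * p j k)"
      using P ij by (intro sum.cong) (auto simp: X_def PD p_def simp del: index_mult_mat)
    finally show ?thesis .
  qed
  show thesis using that[of p d] 1 2 3 by blast
qed

section \<open>Signature of Lorentzian forms\<close>

text \<open>
  The symmetric bilinear form of the Hessian; on the diagonal it is twice the quadratic form \<open>c\<close>.
\<close>

definition hessian_form :: "nat \<Rightarrow> qform \<Rightarrow> (nat \<Rightarrow> real) \<Rightarrow> (nat \<Rightarrow> real) \<Rightarrow> real" where
  "hessian_form n c x y = (\<Sum>i<n. \<Sum>j<n. hessian n c $$ (i, j) * x i * y j)"

text \<open>
  The last clause turns the eigenvalue counts in the definition of a strictly Lorentzian form into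
  counts of indices in the diagonalization.
\<close>

lemma hessian_diagonalization:
  "\<exists>p d.
    (\<forall>k<n. \<forall>l<n. (\<Sum>i<n. p i k * p i l) = (if k = l then 1 else 0)) \<and>
    (\<forall>i<n. \<forall>j<n. hessian n c $$ (i, j) = (\<Sum>k<n. d k * p i k * p j k)) \<and>
    (\<forall>x y. hessian_form n c x y = (\<Sum>k<n. d k * (\<Sum>i<n. p i k * x i) * (\<Sum>i<n. p i k * y i))) \<and>
    (\<forall>R. size (filter_mset R (proots (char_poly (hessian n c)))) = card {k. k < n \<and> R (d k)})"
proof -
  have H: "hessian n c \<in> carrier_mat n n" by (simp add: hessian_def)
  have HT: "(hessian n c)\<^sup>T = hessian n c" by (rule eq_matI) (auto simp: hessian_def min.commute max.commute)
  obtain p d where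
    1: "\<And>k l. k < n \<Longrightarrow> l < n \<Longrightarrow> (\<Sum>i<n. p i k * p i l) = (if k = l then 1 else 0)" and
    2: "\<And>i j. i < n \<Longrightarrow> j < n \<Longrightarrow> hessian n c $$ (i, j) = (\<Sum>k<n. d k * p i k * p j k)" and
    3: "proots (char_poly (hessian n c)) = image_mset d (mset_set {..<n})"
    using symmetric_mat_diagonalization[OF H HT] by blast
  have 4: "hessian_form n c x y = (\<Sum>k<n. d k * (\<Sum>i<n. p i k * x i) * (\<Sum>i<n. p i k * y i))" for x y
  proof -
    have "hessian_form n c x y = (\<Sum>i<n. \<Sum>j<n. \<Sum>k<n. d k * (p i k * x i) * (p j k * y j))"
      unfolding hessian_form_def
      by (intro sum.cong refl) (simp add: 2 sum_distrib_right mult.assoc mult.left_commute)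
    also have "\<dots> = (\<Sum>k<n. \<Sum>i<n. \<Sum>j<n. d k * (p i k * x i) * (p j k * y j))"
      (is "_ = ?r")
    proof -
      have "(\<Sum>i<n. \<Sum>j<n. \<Sum>k<n. d k * (p i k * x i) * (p j k * y j)) =
            (\<Sum>i<n. \<Sum>k<n. \<Sum>j<n. d k * (p i k * x i) * (p j k * y j))"
        by (rule sum.cong[OF refl], rule sum.swap)
      also have "\<dots> = ?r" by (rule sum.swap)
      finally show ?thesis .
    qed
    also have "\<dots> = (\<Sum>k<n. d k * (\<Sum>i<n. p i k * x i) * (\<Sum>i<n. p i k * y i))"
      unfolding sum_distrib_left[symmetric] sum_distrib_right[symmetric] ..
    finally show ?thesis .
  qed
  have 5: "size (filter_mset R (proots (char_poly (hessian n c)))) = card {k. k < n \<and> R (d k)}" for R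
    unfolding 3 by (simp add: filter_mset_image_mset filter_mset_mset_set)
  show ?thesis using 1 2 4 5 by blast
qed

text \<open>
  The form is nonpositive on the hyperplane where the coordinate \<open>k0\<close> of the positive eigenvector
  vanishes. The plane spanned by \<open>u\<close> and \<open>v\<close> meets this hyperplane, so the form cannot be
  positive definite on the plane.
\<close>

lemma strictly_lorentzian_reverse_Cauchy_Schwarz:
  assumes c: "strictly_lorentzian n c" and u: "hessian_form n c u u > 0"
  shows "hessian_form n c u u * hessian_form n c v v \<le> (hessian_form n c u v)^2"
proof -
  obtain p d where
    Q: "\<And>x y. hessian_form n c x y = (\<Sum>k<n. d k * (\<Sum>i<n. p i k * x i) * (\<Sum>i<n. p i k * y i))" and
    roots: "\<And>R. size (filter_mset R (proots (char_poly (hessian n c)))) = card {k. k < n \<and> R (d k)}"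
    using hessian_diagonalization[of n c] by blast
  define L where "L x k = (\<Sum>i<n. p i k * x i)" for x k
  have "card {k. k < n \<and> d k > 0} = 1"
    using c roots[of "\<lambda>a. a > 0"] by (simp add: strictly_lorentzian_def)
  then obtain k0 where k0: "{k. k < n \<and> d k > 0} = {k0}" by (auto simp: card_1_singleton_iff)
  have neg: "hessian_form n c x x \<le> 0" if "L x k0 = 0" for x
    unfolding Q L_def[symmetric]
  proof (rule sum_nonpos)
    fix k assume "k \<in> {..<n}"
    then have "k = k0 \<or> d k \<le> 0" using k0 by force
    then show "d k * L x k * L x k \<le> 0"
      using that by (auto simp: mult.assoc intro: mult_nonpos_nonneg)
  qed
  define a where "a = L u k0"
  define b where "b = L v k0"
  define uu where "uu = hessian_form n c u u"
  define uv where "uv = hessian_form n c u v"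
  define vv where "vv = hessian_form n c v v"
  have L: "L (\<lambda>i. b * u i - a * v i) k = b * L u k - a * L v k" for k
    by (simp add: L_def sum_subtractf sum_distrib_left algebra_simps)
  have "hessian_form n c (\<lambda>i. b * u i - a * v i) (\<lambda>i. b * u i - a * v i) = b^2 * uu - 2 * a * b * uv + a^2 * vv"
    unfolding uu_def uv_def vv_def Q L_def[symmetric] L
    by (simp add: sum_distrib_left sum_subtractf sum.distrib algebra_simps power2_eq_square)
  moreover have "L (\<lambda>i. b * u i - a * v i) k0 = 0" unfolding L by (simp add: a_def b_def)
  ultimately have w: "b^2 * uu - 2 * a * b * uv + a^2 * vv \<le> 0" using neg by metis
  have uu: "uu > 0" using u by (simp add: uu_def)
  have a: "a \<noteq> 0" using neg[of u] u by (auto simp: a_def)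
  have "(b * uu - a * uv)^2 + a^2 * (uu * vv - uv^2) = uu * (b^2 * uu - 2 * a * b * uv + a^2 * vv)"
    by (simp add: power2_eq_square algebra_simps)
  also have "\<dots> \<le> 0" using w uu by (simp add: mult_nonneg_nonpos)
  finally have "a^2 * (uu * vv - uv^2) \<le> 0" using zero_le_power2[of "b * uu - a * uv"] by linarith
  then have "uu * vv - uv^2 \<le> 0" using a by (simp add: mult_le_0_iff)
  then show ?thesis by (simp add: uu_def uv_def vv_def)
qed

text \<open>
  The reversed inequality passes to limits, since \<open>hessian_form n c u u > 0\<close> is an open condition
  on \<open>c\<close>.
\<close>

lemma lorentzian_reverse_Cauchy_Schwarz:
  assumes c: "lorentzian n c" and u: "hessian_form n c u u > 0"
  shows "hessian_form n c u u * hessian_form n c v v \<le> (hessian_form n c u v)^2"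
proof -
  obtain F where F: "\<And>m. strictly_lorentzian n (F m)" and lim: "\<And>i j. (\<lambda>m. F m i j) \<longlonglongrightarrow> c i j"
    using c by (auto simp: lorentzian_def)
  have H: "(\<lambda>m. hessian_form n (F m) x y) \<longlonglongrightarrow> hessian_form n c x y" for x y
    unfolding hessian_form_def
    by (intro tendsto_sum tendsto_mult tendsto_const) (auto simp: hessian_def intro!: tendsto_mult lim)
  have "\<forall>\<^sub>F m in sequentially. hessian_form n (F m) u u > 0"
    using order_tendstoD(1)[OF H u] .
  then have "\<forall>\<^sub>F m in sequentially. hessian_form n (F m) u u * hessian_form n (F m) v v
               \<le> (hessian_form n (F m) u v)^2"
    by eventually_elim (rule strictly_lorentzian_reverse_Cauchy_Schwarz[OF F])
  then show ?thesis
    by (intro tendsto_le[OF _ tendsto_power[OF H] tendsto_mult[OF H H]]) auto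
qed

text \<open>
  A converse: a trivial kernel excludes the eigenvalue \<open>0\<close>, and two eigenvectors with positive
  eigenvalues would span a plane that meets the hyperplane \<open>\<Sum>i<n. l i * x i = 0\<close>, where the form is
  nonpositive.
\<close>

lemma strictly_lorentzianI:
  assumes c: "c \<in> qforms n" "nonneg_coeffs c"
    and ker: "\<And>x i. (\<And>i. i < n \<Longrightarrow> (\<Sum>j<n. hessian n c $$ (i, j) * x j) = 0) \<Longrightarrow> i < n \<Longrightarrow> x i = 0"
    and nonpos: "\<And>x. (\<Sum>i<n. l i * x i) = 0 \<Longrightarrow> hessian_form n c x x \<le> 0"
    and pos: "hessian_form n c u u > 0"
  shows "strictly_lorentzian n c"
proof -
  obtain p d where
    orth: "\<And>k l. k < n \<Longrightarrow> l < n \<Longrightarrow> (\<Sum>i<n. p i k * p i l) = (if k = l then 1 else 0)" and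
    entry: "\<And>i j. i < n \<Longrightarrow> j < n \<Longrightarrow> hessian n c $$ (i, j) = (\<Sum>k<n. d k * p i k * p j k)" and
    Q: "\<And>x y. hessian_form n c x y = (\<Sum>k<n. d k * (\<Sum>i<n. p i k * x i) * (\<Sum>i<n. p i k * y i))" and
    roots: "\<And>R. size (filter_mset R (proots (char_poly (hessian n c)))) = card {k. k < n \<and> R (d k)}"
    using hessian_diagonalization[of n c] by blast
  have d0: "d k \<noteq> 0" if k: "k < n" for k
  proof
    assume d: "d k = 0"
    have "(\<Sum>j<n. hessian n c $$ (i, j) * p j k) = 0" if i: "i < n" for i
    proof -
      have "(\<Sum>j<n. hessian n c $$ (i, j) * p j k) = (\<Sum>j<n. \<Sum>l<n. d l * p i l * (p j l * p j k))"
        using i by (intro sum.cong) (auto simp: entry sum_distrib_right mult.assoc)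
      also have "\<dots> = (\<Sum>l<n. d l * p i l * (\<Sum>j<n. p j l * p j k))"
        by (subst sum.swap) (simp add: sum_distrib_left)
      also have "\<dots> = 0" using k d by (intro sum.neutral) (auto simp: orth)
      finally show ?thesis .
    qed
    then have "p i k = 0" if "i < n" for i using ker[of "\<lambda>j. p j k"] that by blast
    then have "(\<Sum>i<n. p i k * p i k) = 0" by simp
    then show False using orth[OF k k] by simp
  qed
  have uniq: "k = m" if k: "k < n" "d k > 0" and m: "m < n" "d m > 0" for k m
  proof (rule ccontr)
    assume km: "k \<noteq> m"
    have val: "hessian_form n c (\<lambda>i. a * p i k + b * p i m) (\<lambda>i. a * p i k + b * p i m) = a^2 * d k + b^2 * d m"
      for a b
    proof -
      have "(\<Sum>i<n. p i r * (a * p i k + b * p i m)) = a * (if r = k then 1 else 0) + b * (if r = m then 1 else 0)"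
        if "r < n" for r
        using orth[OF that k(1)] orth[OF that m(1)]
        by (simp add: distrib_left sum.distrib mult.left_commute[of _ a] mult.left_commute[of _ b]
              flip: sum_distrib_left)
      then have "hessian_form n c (\<lambda>i. a * p i k + b * p i m) (\<lambda>i. a * p i k + b * p i m) =
         (\<Sum>r<n. d r * (a * (if r = k then 1 else 0) + b * (if r = m then 1 else 0))
              * (a * (if r = k then 1 else 0) + b * (if r = m then 1 else 0)))"
        unfolding Q by (intro sum.cong) auto
      also have "\<dots> = (\<Sum>r<n. (if r = k then a^2 * d k else 0) + (if r = m then b^2 * d m else 0))"
        using km by (intro sum.cong) (auto simp: power2_eq_square)
      also have "\<dots> = a^2 * d k + b^2 * d m" using k m by (simp add: sum.distrib)
      finally show ?thesis .
    qed
    define a where "a = (\<Sum>i<n. l i * p i k)"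
    define b where "b = (\<Sum>i<n. l i * p i m)"
    have lin: "(\<Sum>i<n. l i * (s * p i k + t * p i m)) = s * a + t * b" for s t
      by (simp add: a_def b_def sum_distrib_left sum.distrib algebra_simps)
    \<comment> \<open>\<open>b p\<^sub>k - a p\<^sub>m\<close> lies in the hyperplane\<close>
    have "b^2 * d k + (- a)^2 * d m \<le> 0"
      unfolding val[symmetric] by (rule nonpos) (simp only: lin, simp)
    moreover have "b^2 * d k \<ge> 0" "(- a)^2 * d m \<ge> 0" using k m by auto
    ultimately have "(- a)^2 * d m = 0" by linarith
    then have "a = 0" using m by simp
    then have "1^2 * d k + 0^2 * d m \<le> 0"
      unfolding val[symmetric] by (intro nonpos) (subst lin, simp)
    then show False using k by simp
  qed
  have ex: "\<exists>k<n. d k > 0"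
  proof (rule ccontr)
    assume "\<not> ?thesis"
    then have "hessian_form n c u u \<le> 0"
      unfolding Q
    proof (intro sum_nonpos)
      fix k assume "k \<in> {..<n}"
      then have "d k \<le> 0" using \<open>\<not> (\<exists>k<n. d k > 0)\<close> by force
      then show "d k * (\<Sum>i<n. p i k * u i) * (\<Sum>i<n. p i k * u i) \<le> 0"
        by (simp add: mult.assoc mult_nonpos_nonneg)
    qed
    then show False using pos by simp
  qed
  then obtain k where k: "k < n" "d k > 0" by blast
  have P: "{k. k < n \<and> d k > 0} = {k}" using k uniq by auto
  have "{k. k < n \<and> d k < 0} = {..<n} - {k. k < n \<and> d k > 0}" using d0 by force
  also have "card \<dots> = n - 1" unfolding P using k by simp
  finally have "card {k. k < n \<and> d k < 0} = n - 1" .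
  then show ?thesis unfolding strictly_lorentzian_def using c roots P by simp
qed

section \<open>Weak representations as metrics\<close>

text \<open>
  A weak representation \<open>\<rho>\<close> of the uniform matroid of rank \<open>2\<close> on \<open>Suc m\<close> elements. The last element
  \<open>m\<close> plays the role of a point at infinity.
\<close>

locale weak_representation =
  fixes m :: nat and q :: real and \<rho> :: "nat \<Rightarrow> nat \<Rightarrow> real"
  assumes rep: "weak_rep q (Suc m) \<rho>" and m: "m \<ge> 1" and q0: "q > 0"
begin

abbreviation n :: nat where "n \<equiv> Suc m"

text \<open>
  The Hessian row of the element \<open>m\<close>, used to rescale the other variables.
\<close>

definition r :: "nat \<Rightarrow> real" where "r i = \<rho> i m"

text \<open>
  The four-point condition for quadruples containing \<open>m\<close> says exactly that
  \<open>(\<rho>\<^sub>i\<^sub>j / (\<rho>\<^sub>i\<^sub>m \<rho>\<^sub>j\<^sub>m))\<^bsup>1/q\<^esup>\<close> is a metric on the remaining \<open>m\<close> elements.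
\<close>

definition link_dist :: "nat \<Rightarrow> nat \<Rightarrow> real" where
  "link_dist i j = (if i = j then 0 else (\<rho> (min i j) (max i j) / (r i * r j)) powr (1 / q))"

text \<open>
  Approximations of the form of \<open>\<rho>\<close>. In the rescaled variables \<open>r i * x i\<close>, the number \<open>e\<close> is added to
  all mixed coefficients not involving \<open>m\<close>. This keeps the squares out, so the coefficients remain
  nonnegative, and it makes the form negative wherever the rescaled variables with \<open>i < m\<close> have sum \<open>0\<close>
  without all being \<open>0\<close>, if \<open>d\<^sup>q\<close> is of negative type for the metric \<open>d\<close> above.
\<close>

definition perturbed :: "real \<Rightarrow> qform" where
  "perturbed e = (\<lambda>i j. if i < j \<and> j < n then \<rho> i j + (if j = m then 0 else e * r i * r j) else 0)"

lemma rho_pos: "i < j \<Longrightarrow> j < n \<Longrightarrow> 0 < \<rho> i j"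
  using rep by (simp add: weak_rep_def)

lemma r_pos: "i < m \<Longrightarrow> 0 < r i"
  using rho_pos by (simp add: r_def)

lemma link_dist_sym: "link_dist i j = link_dist j i"
  by (simp add: link_dist_def min.commute max.commute mult.commute)

lemma link_dist_pos: "i < m \<Longrightarrow> j < m \<Longrightarrow> i \<noteq> j \<Longrightarrow> 0 < link_dist i j"
  using rho_pos[of "min i j" "max i j"] r_pos[of i] r_pos[of j] by (auto simp: link_dist_def min_def max_def)

lemma link_dist_triangle_sides:
  assumes ijk: "i < j" "j < k" "k < m"
  shows "triangle_sides (link_dist i j) (link_dist i k) (link_dist j k)"
proof -
  \<comment> \<open>the three sides of the quadruple \<open>i, j, k, m\<close> are the distances times the common factor \<open>R\<close>\<close>
  define R where "R = (r i * r j * r k) powr (1 / q)"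
  have R: "R > 0" using r_pos[of i] r_pos[of j] r_pos[of k] ijk by (simp add: R_def)
  have "triangle_sides ((\<rho> i j * \<rho> k m) powr (1 / q)) ((\<rho> i k * \<rho> j m) powr (1 / q))
     ((\<rho> i m * \<rho> j k) powr (1 / q))"
    using rep ijk by (simp add: weak_rep_def)
  moreover have "(\<rho> i j * \<rho> k m) powr (1 / q) = link_dist i j * R"
    using ijk r_pos[of i] r_pos[of j] r_pos[of k] rho_pos[of i j]
    by (simp add: link_dist_def R_def r_def[of k, symmetric] flip: powr_mult)
  moreover have "(\<rho> i k * \<rho> j m) powr (1 / q) = link_dist i k * R"
    using ijk r_pos[of i] r_pos[of j] r_pos[of k] rho_pos[of i k]
    by (simp add: link_dist_def R_def r_def[of j, symmetric] flip: powr_mult)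
  moreover have "(\<rho> i m * \<rho> j k) powr (1 / q) = link_dist j k * R"
    using ijk r_pos[of i] r_pos[of j] r_pos[of k] rho_pos[of j k]
    by (simp add: link_dist_def R_def r_def[of i, symmetric] mult.commute flip: powr_mult)
  ultimately show ?thesis
    using R by (simp add: triangle_sides_def flip: distrib_right)
qed

lemma link_dist_triangle:
  assumes "i < m" "j < m" "k < m"
  shows "link_dist i k \<le> link_dist i j + link_dist j k"
proof (cases "i = j \<or> j = k \<or> i = k")
  case True
  have "0 \<le> link_dist a b" for a b by (simp add: link_dist_def)
  moreover have "link_dist a a = 0" for a by (simp add: link_dist_def)
  ultimately show ?thesis using True by (metis add.left_neutral add.right_neutral add_nonneg_nonneg order_refl)
next
  case False
  then consider "i < j" "j < k" | "i < k" "k < j" | "j < i" "i < k" | "j < k" "k < i" | "k < i" "i < j" | "k < j" "j < i"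
    by linarith
  then show ?thesis
    using assms link_dist_triangle_sides link_dist_sym unfolding triangle_sides_def by cases (smt (verit))+
qed

lemma link_form_nonpos:
  assumes q: "q \<le> 1" and qn: "(2 powr q - 1) * (real m - 1) \<le> 2 powr q" and y: "(\<Sum>i<m. y i) = 0"
  shows "(\<Sum>i<m. \<Sum>j<m. link_dist i j powr q * y i * y j) \<le> 0"
  by (rule metric_powr_negative_type[of "{..<m}" q link_dist])
     (use q0 q qn m y link_dist_sym link_dist_pos link_dist_triangle in \<open>auto simp: link_dist_def lessThan_empty_iff\<close>)

lemma hessian_perturbed:
  assumes "i < m" "j < m"
  shows "hessian n (perturbed e) $$ (i, j) = (link_dist i j powr q + (if i = j then 0 else e)) * (r i * r j)"
proof (cases "i = j")
  case True
  then show ?thesis using assms by (simp add: hessian_def perturbed_def link_dist_def)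
next
  case False
  have "link_dist i j powr q = \<rho> (min i j) (max i j) / (r i * r j)"
    using False q0 rho_pos[of "min i j" "max i j"] r_pos[of i] r_pos[of j] assms
    by (auto simp: link_dist_def powr_powr min_def max_def)
  moreover have "hessian n (perturbed e) $$ (i, j) = \<rho> (min i j) (max i j) + e * (r i * r j)"
    using False assms by (auto simp: hessian_def perturbed_def min_def max_def)
  ultimately show ?thesis
    using False r_pos[of i] r_pos[of j] assms by (simp add: field_simps)
qed

lemma hessian_perturbed_last:
  "i < m \<Longrightarrow> hessian n (perturbed e) $$ (i, m) = r i"
  "i < m \<Longrightarrow> hessian n (perturbed e) $$ (m, i) = r i"
  "hessian n (perturbed e) $$ (m, m) = 0"
  by (auto simp: hessian_def perturbed_def r_def)

lemma hessian_form_perturbed: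
  "hessian_form n (perturbed e) x x =
     (\<Sum>i<m. \<Sum>j<m. link_dist i j powr q * (r i * x i) * (r j * x j))
     + e * ((\<Sum>i<m. r i * x i)^2 - (\<Sum>i<m. (r i * x i)^2)) + 2 * x m * (\<Sum>i<m. r i * x i)"
proof -
  have "hessian_form n (perturbed e) x x =
     (\<Sum>i<m. \<Sum>j<m. hessian n (perturbed e) $$ (i, j) * x i * x j) + 2 * x m * (\<Sum>i<m. r i * x i)"
    unfolding hessian_form_def
    by (simp add: sum.distrib hessian_perturbed_last sum_distrib_left algebra_simps)
  also have "(\<Sum>i<m. \<Sum>j<m. hessian n (perturbed e) $$ (i, j) * x i * x j) =
     (\<Sum>i<m. \<Sum>j<m. link_dist i j powr q * (r i * x i) * (r j * x j)
        + (e * ((r i * x i) * (r j * x j)) - (if j = i then e * (r i * x i)^2 else 0)))"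
    by (intro sum.cong refl) (auto simp: hessian_perturbed power2_eq_square algebra_simps)
  also have "\<dots> = (\<Sum>i<m. \<Sum>j<m. link_dist i j powr q * (r i * x i) * (r j * x j))
      + e * ((\<Sum>i<m. r i * x i)^2 - (\<Sum>i<m. (r i * x i)^2))"
  proof -
    have "(\<Sum>i<m. \<Sum>j<m. e * ((r i * x i) * (r j * x j))) = e * (\<Sum>i<m. r i * x i)^2"
      by (simp only: power2_eq_square sum_product sum_distrib_left[symmetric])
    moreover have "(\<Sum>i<m. e * (r i * x i)^2) = e * (\<Sum>i<m. (r i * x i)^2)"
      by (simp only: sum_distrib_left)
    ultimately show ?thesis by (simp add: sum.distrib sum_subtractf right_diff_distrib)
  qed
  finally show ?thesis .
qed

text \<open>
  Negative type makes the form nonpositive on the hyperplane \<open>\<Sum>i<m. r i * x i = 0\<close>. The kernel lies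
  in it, by the last row of the Hessian, so the perturbation forces \<open>x i = 0\<close> for \<open>i < m\<close>, and
  then the first row gives \<open>x m = 0\<close>.
\<close>

lemma strictly_lorentzian_perturbed:
  assumes q: "q \<le> 1" and qn: "(2 powr q - 1) * (real m - 1) \<le> 2 powr q" and e: "e > 0"
  shows "strictly_lorentzian n (perturbed e)"
proof -
  have bound: "hessian_form n (perturbed e) x x \<le> - e * (\<Sum>i<m. (r i * x i)^2)"
    if "(\<Sum>i<m. r i * x i) = 0" for x
    using link_form_nonpos[OF q qn that] that by (simp add: hessian_form_perturbed)
  show ?thesis
  proof (rule strictly_lorentzianI)
    show "perturbed e \<in> qforms n" by (auto simp: perturbed_def qforms_def)
    show "nonneg_coeffs (perturbed e)"
      using e rho_pos r_pos
      by (auto simp: nonneg_coeffs_def perturbed_def less_Suc_eq intro!: add_nonneg_nonneg mult_nonneg_nonneg less_imp_le[OF rho_pos] less_imp_le[OF r_pos])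
    show "hessian_form n (perturbed e) x x \<le> 0"
      if "(\<Sum>i<n. (if i < m then r i else 0) * x i) = 0" for x
    proof -
      have s: "(\<Sum>i<m. r i * x i) = 0" using that by simp
      have "0 \<le> e * (\<Sum>i<m. (r i * x i)^2)" using e by (intro mult_nonneg_nonneg sum_nonneg) auto
      then show ?thesis using bound[OF s] by simp
    qed
    show "0 < hessian_form n (perturbed e) (\<lambda>_. 1) (\<lambda>_. 1)"
    proof -
      have "0 < hessian n (perturbed e) $$ (0, m)" using hessian_perturbed_last(1)[of 0] r_pos[of 0] m by simp
      moreover have nn: "0 \<le> hessian n (perturbed e) $$ (i, j)" if "i < n" "j < n" for i j
        using \<open>nonneg_coeffs (perturbed e)\<close> that by (simp add: hessian_def nonneg_coeffs_def)
      ultimately show ?thesis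
        unfolding hessian_form_def
        by (intro sum_pos2[of _ 0] sum_pos2[of _ m] sum_nonneg) auto
    qed
    show "x i = 0" if K: "\<And>i. i < n \<Longrightarrow> (\<Sum>j<n. hessian n (perturbed e) $$ (i, j) * x j) = 0" and i: "i < n"
      for x i
    proof -
      have s: "(\<Sum>j<m. r j * x j) = 0"
        using K[of m] hessian_perturbed_last by simp
      have "hessian_form n (perturbed e) x x = (\<Sum>i<n. x i * (\<Sum>j<n. hessian n (perturbed e) $$ (i, j) * x j))"
        by (simp add: hessian_form_def sum_distrib_left mult_ac del: sum.lessThan_Suc)
      also have "\<dots> = 0" using K by simp
      finally have "e * (\<Sum>i<m. (r i * x i)^2) \<le> 0" using bound[OF s] by simp
      then have "(\<Sum>i<m. (r i * x i)^2) = 0"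
        using e by (intro antisym sum_nonneg) (auto simp: mult_le_0_iff)
      then have xi: "x i = 0" if "i < m" for i
        using that r_pos[of i] by (subst (asm) sum_nonneg_eq_0_iff) force+
      have "r 0 * x m = 0"
        using K[of 0] m xi hessian_perturbed_last(1)[of 0 e] by simp
      then have "x m = 0" using r_pos[of 0] m by simp
      then show ?thesis using xi i less_Suc_eq by auto
    qed
  qed
qed

lemma lorentzian_form_of_rep:
  assumes q: "q \<le> 1" and qn: "(2 powr q - 1) * (real m - 1) \<le> 2 powr q"
  shows "lorentzian n (form_of_rep n \<rho>)"
  unfolding lorentzian_def
proof (intro conjI exI[of _ "\<lambda>k. perturbed (1 / real (Suc k))"] allI)
  show "form_of_rep n \<rho> \<in> qforms n" by (auto simp: form_of_rep_def qforms_def)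
  show "nonneg_coeffs (form_of_rep n \<rho>)"
    using rho_pos by (auto simp: form_of_rep_def nonneg_coeffs_def intro: less_imp_le)
  show "strictly_lorentzian n (perturbed (1 / real (Suc k)))" for k
    by (rule strictly_lorentzian_perturbed[OF q qn]) simp
  show "(\<lambda>k. perturbed (1 / real (Suc k)) i j) \<longlonglongrightarrow> form_of_rep n \<rho> i j" for i j
  proof -
    have "(\<lambda>k. 1 / real (Suc k)) \<longlonglongrightarrow> 0" by (rule LIMSEQ_Suc[OF lim_1_over_n])
    then have "(\<lambda>k. \<rho> i j + 1 / real (Suc k) * r i * r j) \<longlonglongrightarrow> \<rho> i j + 0 * r i * r j"
      by (intro tendsto_intros)
    then show ?thesis
      by (cases "j = m"; cases "i < j"; cases "j < n") (simp_all add: perturbed_def form_of_rep_def)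
  qed
qed

end

section \<open>The lower bound\<close>

lemma form_of_rep_support:
  assumes "weak_rep q n \<rho>"
  shows "{(i, j). form_of_rep n \<rho> i j \<noteq> 0} = {(i, j). i < j \<and> j < n}"
proof -
  have "\<rho> i j \<noteq> 0" if "i < j" "j < n" for i j
    using assms that unfolding weak_rep_def by force
  then show ?thesis by (auto simp: form_of_rep_def)
qed

text \<open>
  Both sides of the inclusion are sets of classes modulo scaling. This lemma and the next one pass between
  classes and representatives; the next one uses that the reversed Cauchy--Schwarz inequality
  is invariant under positive scaling.
\<close>

lemma Gr_subset_PLI:
  assumes "\<And>\<rho>. weak_rep q n \<rho> \<Longrightarrow> lorentzian n (form_of_rep n \<rho>)"
  shows "Gr_w_U2 q n \<subseteq> PL_U2 n"
proof
  fix X assume "X \<in> Gr_w_U2 q n"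
  then obtain \<rho> where \<rho>: "weak_rep q n \<rho>" and X: "X = pos_scaling n `` {form_of_rep n \<rho>}"
    unfolding Gr_w_U2_def by (elim quotientE) blast
  show "X \<in> PL_U2 n"
    unfolding PL_U2_def X using assms[OF \<rho>] form_of_rep_support[OF \<rho>] by (intro quotientI CollectI conjI)
qed

lemma reverse_Cauchy_Schwarz_of_Gr_subset_PL:
  assumes sub: "Gr_w_U2 q n \<subseteq> PL_U2 n" and \<rho>: "weak_rep q n \<rho>"
    and u: "hessian_form n (form_of_rep n \<rho>) u u > 0"
  shows "hessian_form n (form_of_rep n \<rho>) u u * hessian_form n (form_of_rep n \<rho>) v v
         \<le> (hessian_form n (form_of_rep n \<rho>) u v)^2"
proof -
  let ?f = "form_of_rep n \<rho>"
  have f: "?f \<in> qforms n" by (auto simp: form_of_rep_def qforms_def)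
  have "pos_scaling n `` {?f} \<in> Gr_w_U2 q n"
    unfolding Gr_w_U2_def using \<rho> by (intro quotientI) blast
  then have "pos_scaling n `` {?f} \<in> PL_U2 n" using sub by blast
  then obtain c where c: "lorentzian n c" and eq: "pos_scaling n `` {?f} = pos_scaling n `` {c}"
    unfolding PL_U2_def by (elim quotientE) blast
  have "?f \<in> pos_scaling n `` {?f}" using f by (auto simp: pos_scaling_def intro: exI[of _ 1])
  then have "(c, ?f) \<in> pos_scaling n" unfolding eq by simp
  then obtain t where t: "t > 0" and ft: "\<And>i j. ?f i j = t * c i j" by (auto simp: pos_scaling_def)
  have h: "hessian n ?f $$ (i, j) = t * hessian n c $$ (i, j)" if "i < n" "j < n" for i j
    using that by (simp add: hessian_def ft)
  have H: "hessian_form n ?f x y = t * hessian_form n c x y" for x y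
    unfolding hessian_form_def sum_distrib_left by (intro sum.cong refl) (simp add: h)
  have "hessian_form n c u u > 0" using u t by (simp add: H zero_less_mult_iff)
  from mult_left_mono[OF lorentzian_reverse_Cauchy_Schwarz[OF c this, of v], of "t^2"]
  show ?thesis by (simp add: H power2_eq_square mult_ac)
qed

text \<open>
  The lower bound is itself one of the numbers whose supremum is \<open>q_crit n\<close>.
\<close>

lemma lower_bound_mem:
  assumes n: "n \<ge> 4"
  defines "q \<equiv> log 2 ((real n - 1) / (real n - 2))"
  shows "q > 0" "Gr_w_U2 q n \<subseteq> PL_U2 n"
proof -
  have K: "(real n - 1) / (real n - 2) > 1" using n by simp
  show q0: "q > 0" unfolding q_def using K by simp
  have q2: "2 powr q = (real n - 1) / (real n - 2)" unfolding q_def using K by simp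
  have "log 2 ((real n - 1) / (real n - 2)) \<le> log 2 2"
    using K n by (subst log_le_cancel_iff) (simp_all add: field_simps)
  then have q1: "q \<le> 1" by (simp add: q_def)
  show "Gr_w_U2 q n \<subseteq> PL_U2 n"
  proof (rule Gr_subset_PLI)
    fix \<rho> assume \<rho>: "weak_rep q n \<rho>"
    have Suc: "Suc (n - 1) = n" using n by simp
    interpret weak_representation "n - 1" q \<rho>
      by unfold_locales (use \<rho> Suc n q0 in auto)
    have "(2 powr q - 1) * (real (n - 1) - 1) = 1"
      unfolding q2 using n by (simp add: field_simps of_nat_diff)
    also have "1 \<le> 2 powr q" unfolding q2 using K by simp
    finally show "lorentzian n (form_of_rep n \<rho>)"
      using lorentzian_form_of_rep[OF q1] Suc by simp
  qed
qed

section \<open>The upper bound\<close>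

text \<open>
  The elements are divided into the first \<open>a\<close> and the others; pairs within a part have weight
  \<open>2\<^bsup>q/2\<^esup>\<close>, pairs across have weight \<open>1\<close>. Since a quadruple with two elements in each part gives
  the degenerate triangle with sides \<open>2, 1, 1\<close>, the weight within the parts cannot be larger if both
  have at least two elements.
\<close>

definition bipartite_rep :: "real \<Rightarrow> nat \<Rightarrow> nat \<Rightarrow> nat \<Rightarrow> real" where
  "bipartite_rep q a i j = (if (i < a) = (j < a) then 2 powr (q / 2) else 1)"

lemma weak_rep_bipartite_rep:
  assumes q: "q > 0"
  shows "weak_rep q n (bipartite_rep q a)"
proof -
  have "2 powr (q / 2) * 2 powr (q / 2) = (2::real) powr q" by (simp flip: powr_add)
  then have sq: "(2 powr (q / 2) * 2 powr (q / 2)) powr (1 / q) = (2::real)" using q by (simp add: powr_powr)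
  have "triangle_sides ((bipartite_rep q a i j * bipartite_rep q a k l) powr (1 / q))
     ((bipartite_rep q a i k * bipartite_rep q a j l) powr (1 / q))
     ((bipartite_rep q a i l * bipartite_rep q a j k) powr (1 / q))"
    if "i < j" "j < k" "k < l" for i j k l
    using that sq
    by (cases "i < a"; cases "j < a"; cases "k < a"; cases "l < a")
       (simp_all add: bipartite_rep_def triangle_sides_def)
  then show ?thesis by (auto simp: weak_rep_def bipartite_rep_def)
qed

lemma hessian_form_bipartite_rep:
  fixes q :: real
  assumes a: "a \<le> n"
  defines "h \<equiv> hessian_form n (form_of_rep n (bipartite_rep q a))"
    and "u \<equiv> \<lambda>i. if i < a then 1 else 0" and "v \<equiv> \<lambda>i. if i < a then 0 else 1"
  shows "h u u = 2 powr (q / 2) * (real a * (real a - 1))"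
    and "h v v = 2 powr (q / 2) * (real (n - a) * (real (n - a) - 1))"
    and "h u v = real a * real (n - a)"
proof -
  have H: "hessian n (form_of_rep n (bipartite_rep q a)) $$ (i, j) =
      (if i = j then 0 else if (i < a) = (j < a) then 2 powr (q / 2) else 1)"
    if "i < n" "j < n" for i j
    using that by (auto simp: hessian_def form_of_rep_def bipartite_rep_def min_def max_def)
  have su: "(\<Sum>i<n. u i) = real a"
  proof -
    have "{..<n} \<inter> {i. i < a} = {..<a}" using a by auto
    then show ?thesis unfolding u_def by (simp add: sum.If_cases)
  qed
  have sv: "(\<Sum>i<n. v i) = real (n - a)"
  proof -
    have "{..<n} \<inter> - {i. i < a} = {a..<n}" by auto
    then show ?thesis unfolding v_def by (simp add: sum.If_cases)
  qed
  have diag: "(\<Sum>i<n. \<Sum>j<n. s * (w i * w j) - (if j = i then s * w i else 0)) =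
      s * ((\<Sum>i<n. w i) * ((\<Sum>i<n. w i) - 1))" for s :: real and w
  proof -
    have "(\<Sum>i<n. \<Sum>j<n. s * (w i * w j)) = s * ((\<Sum>i<n. w i) * (\<Sum>i<n. w i))"
      by (simp only: sum_product sum_distrib_left[symmetric])
    then show ?thesis by (simp add: sum_subtractf sum_distrib_left[symmetric] right_diff_distrib)
  qed
  have "h u u = (\<Sum>i<n. \<Sum>j<n. 2 powr (q / 2) * (u i * u j) - (if j = i then 2 powr (q / 2) * u i else 0))"
    unfolding h_def hessian_form_def by (intro sum.cong refl) (auto simp: H u_def)
  then show "h u u = 2 powr (q / 2) * (real a * (real a - 1))" unfolding diag su .
  have "h v v = (\<Sum>i<n. \<Sum>j<n. 2 powr (q / 2) * (v i * v j) - (if j = i then 2 powr (q / 2) * v i else 0))"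
    unfolding h_def hessian_form_def by (intro sum.cong refl) (auto simp: H v_def)
  then show "h v v = 2 powr (q / 2) * (real (n - a) * (real (n - a) - 1))" unfolding diag sv .
  have "h u v = (\<Sum>i<n. \<Sum>j<n. u i * v j)"
    unfolding h_def hessian_form_def by (intro sum.cong refl) (auto simp: H u_def v_def)
  then show "h u v = real a * real (n - a)" unfolding sum_product[symmetric] su sv .
qed

text \<open>
  The reversed Cauchy--Schwarz inequality for the indicator vectors of the two parts.
\<close>

lemma Gr_subset_PL_imp_bipartite_bound:
  assumes q: "q > 0" and sub: "Gr_w_U2 q n \<subseteq> PL_U2 n" and a: "2 \<le> a" "a + 2 \<le> n"
  shows "2 powr q * ((real a - 1) * (real (n - a) - 1)) \<le> real a * real (n - a)"
proof -
  have an: "a \<le> n" using a by simp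
  note h = hessian_form_bipartite_rep[OF an, of q]
  have sq: "2 powr (q / 2) * 2 powr (q / 2) = (2::real) powr q" by (simp flip: powr_add)
  have pos: "real a * real (n - a) > 0" using a by simp
  have "2 powr (q / 2) * (real a * (real a - 1)) > 0" using a by simp
  then have "2 powr (q / 2) * (real a * (real a - 1)) * (2 powr (q / 2) * (real (n - a) * (real (n - a) - 1)))
      \<le> (real a * real (n - a))^2"
    using reverse_Cauchy_Schwarz_of_Gr_subset_PL[OF sub weak_rep_bipartite_rep[OF q]]
    unfolding h[symmetric] by blast
  also have "2 powr (q / 2) * (real a * (real a - 1)) * (2 powr (q / 2) * (real (n - a) * (real (n - a) - 1)))
     = (2 powr (q / 2) * 2 powr (q / 2)) * ((real a - 1) * (real (n - a) - 1)) * (real a * real (n - a))"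
    by (simp only: mult_ac)
  finally show ?thesis using pos by (simp only: sq power2_eq_square mult_le_cancel_right_pos)
qed

lemma Gr_subset_PL_imp_upper_bound:
  assumes n: "n \<ge> 4" and q: "q > 0" and sub: "Gr_w_U2 q n \<subseteq> PL_U2 n"
  shows "q \<le> (if even n then 2 * log 2 (real n / (real n - 2)) else log 2 ((real n + 1) / (real n - 3)))"
proof -
  \<comment> \<open>the balanced partition gives the best bound\<close>
  define a where "a = n div 2"
  have B: "2 powr q * ((real a - 1) * (real (n - a) - 1)) \<le> real a * real (n - a)"
    using n by (intro Gr_subset_PL_imp_bipartite_bound q sub) (auto simp: a_def)
  have a2: "a \<ge> 2" using n by (simp add: a_def)
  have q_le: "q \<le> log 2 x" if "2 powr q \<le> x" for x
  proof -
    have "0 < (2::real) powr q" by simp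
    then have "0 < x" using that by linarith
    then show ?thesis using that by (simp add: le_log_iff)
  qed
  show ?thesis
  proof (cases "even n")
    case True
    then have na: "n = 2 * a" by (simp add: a_def)
    have "2 powr q \<le> (real a / (real a - 1))^2"
    proof -
      have "real (n - a) = real a" by (simp add: na)
      then have "2 powr q * (real a - 1)^2 \<le> (real a)^2" using B by (simp add: power2_eq_square)
      moreover have "0 < (real a - 1)^2" using a2 by simp
      ultimately show ?thesis unfolding power_divide by (subst pos_le_divide_eq)
    qed
    then have "q \<le> log 2 ((real a / (real a - 1))^2)" by (rule q_le)
    also have "\<dots> = 2 * log 2 (real a / (real a - 1))" using a2 by (simp add: log_nat_power)
    also have "real a / (real a - 1) = real n / (real n - 2)" 
    proof -
      have "real n = 2 * real a" "real n - 2 = 2 * (real a - 1)" by (simp_all add: na)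
      then show ?thesis by (simp only: mult_divide_mult_cancel_left_if) simp
    qed
    finally show ?thesis using True by simp
  next
    case False
    then have na: "n = 2 * a + 1" by (simp add: a_def)
    have "real a * (2 powr q * (real a - 1)) \<le> real a * (real a + 1)"
    proof -
      have "real (n - a) = real a + 1" by (simp add: na)
      then show ?thesis using B by (simp add: mult_ac)
    qed
    then have "2 powr q * (real a - 1) \<le> real a + 1" using a2 by simp
    then have "2 powr q \<le> (real a + 1) / (real a - 1)" using a2 by (subst pos_le_divide_eq) auto
    also have "\<dots> = (real n + 1) / (real n - 3)" 
    proof -
      have "real n + 1 = 2 * (real a + 1)" "real n - 3 = 2 * (real a - 1)" by (simp_all add: na)
      then show ?thesis by (simp only: mult_divide_mult_cancel_left_if) simp
    qed
    finally show ?thesis using q_le False by simp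
  qed
qed

section \<open>Asymptotics\<close>

lemma one_minus_inverse_le_ln: "x > 0 \<Longrightarrow> 1 - 1 / x \<le> ln (x::real)"
  using ln_le_minus_one[of "inverse x"] by (simp add: ln_inverse divide_inverse)

lemma upper_bound_le_linear:
  assumes n: "n \<ge> 6"
  shows "(if even n then 2 * log 2 (real n / (real n - 2)) else log 2 ((real n + 1) / (real n - 3)))
           \<le> 16 / real n"
proof -
  have ln2: "ln 2 \<ge> (1 / 2 :: real)" using one_minus_inverse_le_ln[of 2] by simp
  have lg: "log 2 x \<le> 2 * (x - 1)" if "x \<ge> 1" for x :: real
  proof -
    have "log 2 x \<le> ln x / (1 / 2)"
      unfolding log_def using ln2 that by (intro divide_left_mono) auto
    also have "\<dots> \<le> 2 * (x - 1)" using ln_le_minus_one[of x] that by simp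
    finally show ?thesis .
  qed
  define x where "x = real n"
  have x: "x \<ge> 6" using n by (simp add: x_def)
  have "2 * log 2 (x / (x - 2)) \<le> 2 * (2 * (x / (x - 2) - 1))"
    using x by (intro mult_left_mono lg) auto
  also have "x / (x - 2) - 1 = 2 / (x - 2)" using x by (simp add: divide_simps)
  also have "2 * (2 * (2 / (x - 2))) \<le> 16 / x"
    using frac_le[of 8 8 "x / 2" "x - 2"] x by simp
  finally have 1: "2 * log 2 (x / (x - 2)) \<le> 16 / x" .
  have "log 2 ((x + 1) / (x - 3)) \<le> 2 * ((x + 1) / (x - 3) - 1)"
    using x by (intro lg) auto
  also have "(x + 1) / (x - 3) - 1 = 4 / (x - 3)" using x by (simp add: divide_simps)
  also have "2 * (4 / (x - 3)) \<le> 16 / x"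
    using frac_le[of 8 8 "x / 2" "x - 3"] x by simp
  finally show ?thesis using 1 by (simp add: x_def)
qed

lemma lower_bound_ge_linear:
  assumes n: "n \<ge> 4"
  shows "1 / real n \<le> log 2 ((real n - 1) / (real n - 2))"
proof -
  define x where "x = (real n - 1) / (real n - 2)"
  have x: "x > 1" using n by (simp add: x_def)
  have "1 / real n \<le> 1 / (real n - 1)" using n by (intro frac_le) auto
  also have "\<dots> = 1 - 1 / x" using n by (simp add: x_def eq_diff_eq flip: add_divide_distrib)
  also have "\<dots> \<le> ln x" using x by (intro one_minus_inverse_le_ln) simp
  also have "\<dots> \<le> log 2 x"
    unfolding log_def using frac_le[of "ln x" "ln x" "ln 2" 1] x ln_2_less_1 by simp
  finally show ?thesis by (simp add: x_def)
qed

theorem mainTheorem8: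
  shows "(\<forall>n::nat. n \<ge> 4 \<longrightarrow>
            ereal (log 2 ((real n - 1) / (real n - 2))) \<le> q_crit n \<and>
            q_crit n \<le> ereal (if even n then 2 * log 2 (real n / (real n - 2))
                              else log 2 ((real n + 1) / (real n - 3)))) \<and>
         (\<lambda>n. real_of_ereal (q_crit n)) \<in> \<Theta>(\<lambda>n. 1 / real n)"
proof -
  define L where "L n = log 2 ((real n - 1) / (real n - 2))" for n :: nat
  define U where "U n = (if even n then 2 * log 2 (real n / (real n - 2))
                         else log 2 ((real n + 1) / (real n - 3)))" for n :: nat
  have lower: "ereal (L n) \<le> q_crit n" if "n \<ge> 4" for n
    unfolding q_crit_def using lower_bound_mem[OF that] by (intro Sup_upper) (auto simp: L_def)
  have upper: "q_crit n \<le> ereal (U n)" if "n \<ge> 4" for n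
    unfolding q_crit_def
  proof (rule Sup_least)
    fix x assume "x \<in> ereal ` {q. q > 0 \<and> Gr_w_U2 q n \<subseteq> PL_U2 n}"
    then obtain q where q: "x = ereal q" "q > 0" "Gr_w_U2 q n \<subseteq> PL_U2 n" by auto
    show "x \<le> ereal (U n)"
      using Gr_subset_PL_imp_upper_bound[OF that q(2,3)] unfolding q(1) ereal_less_eq U_def .
  qed
  have bounds: "1 / real n \<le> real_of_ereal (q_crit n) \<and> real_of_ereal (q_crit n) \<le> 16 / real n"
    if n: "n \<ge> 6" for n
  proof -
    obtain x where x: "q_crit n = ereal x"
      using lower[of n] upper[of n] n by (cases "q_crit n") auto
    then have "L n \<le> x" "x \<le> U n" using lower[of n] upper[of n] n by auto
    moreover have "1 / real n \<le> L n" using lower_bound_ge_linear[of n] n by (simp only: L_def)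
    moreover have "U n \<le> 16 / real n" using upper_bound_le_linear[OF n] by (simp only: U_def)
    ultimately show ?thesis by (simp add: x)
  qed
  have "(\<lambda>n. real_of_ereal (q_crit n)) \<in> \<Theta>(\<lambda>n. 1 / real n)"
  proof (rule bigthetaI)
    show "(\<lambda>n. real_of_ereal (q_crit n)) \<in> O(\<lambda>n. 1 / real n)"
    proof (rule bigoI[of _ 16])
      show "\<forall>\<^sub>F n in sequentially. norm (real_of_ereal (q_crit n)) \<le> 16 * norm (1 / real n)"
        using eventually_ge_at_top[of 6]
      proof eventually_elim
        case (elim n)
        have "0 \<le> 1 / real n" by simp
        then have "0 \<le> real_of_ereal (q_crit n)" using bounds[OF elim] by linarith
        then have "norm (real_of_ereal (q_crit n)) = real_of_ereal (q_crit n)"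
          by (simp only: real_norm_def abs_of_nonneg)
        then show ?case using bounds[OF elim] by (simp only:) simp
      qed
    qed
    show "(\<lambda>n. real_of_ereal (q_crit n)) \<in> \<Omega>(\<lambda>n. 1 / real n)"
    proof (rule landau_omega.bigI[of 1])
      show "\<forall>\<^sub>F n in sequentially. norm (real_of_ereal (q_crit n)) \<ge> 1 * norm (1 / real n)"
        using eventually_ge_at_top[of 6]
      proof eventually_elim
        case (elim n)
        have "1 * norm (1 / real n) = 1 / real n" by simp
        also have "\<dots> \<le> real_of_ereal (q_crit n)" using bounds[OF elim] by blast
        also have "\<dots> \<le> norm (real_of_ereal (q_crit n))" unfolding real_norm_def by (rule abs_ge_self)
        finally show ?case .
      qed
    qed simp
  qed
  then show ?thesis
    using lower[unfolded L_def] upper[unfolded U_def] by (intro conjI allI impI)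
qed

end
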